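(* Let $\kappa=\mu^+$ and let $I$ be a $\kappa$-complete normal ideal on $\mathcal{P}_\kappa(\lambda)$. If $I$ is $(\operatorname{cf}(\mu),\lambda)$-regular, then $I$ is regular. If $\lambda$ is regular, then $I$ is $(\operatorname{cf}(\mu)+1,\lambda)$-regular.
   Context: $\mathcal{P}_\kappa(\lambda)=\{z\subseteq\lambda:|z|<\kappa\}$. Ideals are assumed proper and nonprincipal; $\kappa$-complete means closed under unions of fewer than $\kappa$ sets. $I^+$ is the family of sets not in $I$, $I^*$ the dual filter. For $Z\subseteq\mathcal{P}(X)$ and $x\in X$, $\hat x=\{z\in Z:x\in z\}$. An ideal $I$ on $Z\subseteq\mathcal{P}(X)$ is normal if $\hat x\in I^*$ for all $x\in X$ and for every $\langle A_x:x\in X\rangle\subseteq I$, $\bigcup_{x\in X}(A_x\cap\hat x)\in I$. A refinement of $\langle A_i\rangle$ is $\langle B_i\rangle$ with $B_i\subseteq A_i$. $I$ is $(\alpha,\lambda)$-regular if every $\langle A_i:i<\lambda\rangle\subseteq I^+$ has a refinement $\langle B_i:i<\lambda\rangle\subseteq I^+$ with $\bigcap_{i\in z}B_i=\emptyset$ for every $z\subseteq\lambda$ of ordertype $\alpha$. A normal ideal on a subset of $\mathcal{P}(\lambda)$ is regular if it is $(2,\lambda)$-regular. *)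

theory Defs
  imports Main
begin

unbundle cardinal_syntax

text \<open>
  Ordinals are represented by well-order relations up to \<open>=o\<close>, and cardinals by relations
  satisfying \<^const>\<open>Card_order\<close>. An ordinal \<open>lam\<close>, viewed as the set of smaller
  ordinals, is the field of the relation, and \<open>z \<subseteq> lam\<close> has order type \<open>\<alpha>\<close>
  iff \<open>Restr lam z =o \<alpha>\<close>.
\<close>

definition cf :: "'a rel \<Rightarrow> 'a rel" where
  "cf r = (SOME c. \<exists>K \<subseteq> Field r. cofinal K r \<and> c = |K| \<and>
     (\<forall>L \<subseteq> Field r. cofinal L r \<longrightarrow> |K| \<le>o |L| ))"

text \<open>The ordinal successor, with \<^const>\<open>None\<close> as the new greatest element.\<close>

definition ord_succ :: "'a rel \<Rightarrow> 'a option rel" where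
  "ord_succ r = map_prod Some Some ` r \<union> insert None (Some ` Field r) \<times> {None}"

definition P_less :: "'k rel \<Rightarrow> 'a set \<Rightarrow> 'a set set" where
  "P_less \<kappa> X = {z. z \<subseteq> X \<and> |z| <o \<kappa>}"

definition ideal_on :: "'z set \<Rightarrow> 'z set set \<Rightarrow> bool" where
  "ideal_on Z I \<longleftrightarrow>
     I \<subseteq> Pow Z \<and> {} \<in> I \<and>
     (\<forall>A\<in>I. \<forall>B. B \<subseteq> A \<longrightarrow> B \<in> I) \<and>
     (\<forall>A\<in>I. \<forall>B\<in>I. A \<union> B \<in> I) \<and>
     Z \<notin> I \<and> \<not> (\<exists>B. I = Pow B)"

definition complete_ideal :: "'k rel \<Rightarrow> 'z set set \<Rightarrow> bool" where
  "complete_ideal \<kappa> I \<longleftrightarrow> (\<forall>S \<subseteq> I. |S| <o \<kappa> \<longrightarrow> \<Union>S \<in> I)"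

definition positive_sets :: "'z set \<Rightarrow> 'z set set \<Rightarrow> 'z set set" where
  "positive_sets Z I = {A. A \<subseteq> Z \<and> A \<notin> I}"

definition dual_filter :: "'z set \<Rightarrow> 'z set set \<Rightarrow> 'z set set" where
  "dual_filter Z I = {A. A \<subseteq> Z \<and> Z - A \<in> I}"

definition hat :: "'a set set \<Rightarrow> 'a \<Rightarrow> 'a set set" where
  "hat Z x = {z \<in> Z. x \<in> z}"

definition normal_ideal :: "'a set \<Rightarrow> 'a set set \<Rightarrow> 'a set set set \<Rightarrow> bool" where
  "normal_ideal X Z I \<longleftrightarrow>
     (\<forall>x\<in>X. hat Z x \<in> dual_filter Z I) \<and>
     (\<forall>A. (\<forall>x\<in>X. A x \<in> I) \<longrightarrow> (\<Union>x\<in>X. A x \<inter> hat Z x) \<in> I)"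

definition ord_regular_ideal :: "'o rel \<Rightarrow> 'i rel \<Rightarrow> 'z set \<Rightarrow> 'z set set \<Rightarrow> bool" where
  "ord_regular_ideal \<alpha> lam Z I \<longleftrightarrow>
     (\<forall>A. (\<forall>i\<in>Field lam. A i \<in> positive_sets Z I) \<longrightarrow>
       (\<exists>B. (\<forall>i\<in>Field lam. B i \<in> positive_sets Z I \<and> B i \<subseteq> A i) \<and>
            (\<forall>z \<subseteq> Field lam. Restr lam z =o \<alpha> \<longrightarrow> (\<Inter>i\<in>z. B i) = {})))"

definition regular_ideal :: "'a rel \<Rightarrow> 'a set set \<Rightarrow> 'a set set set \<Rightarrow> bool" where
  "regular_ideal lam Z I \<longleftrightarrow> ord_regular_ideal (natLeq_on 2) lam Z I"

end

theory Submission imports Defs begin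

text \<open>
  Write \<open>\<theta> = cf \<mu>\<close>. A family of positive sets \<open>A\<^sub>i\<close>, \<open>i < \<lambda>\<close>, each of which
  carries an antichain of size \<open>> \<lambda>\<close>, has a disjoint refinement by the argument of Baumgartner,
  Hajnal and Mate. As in Shelah's theorem that collapsing \<open>\<lambda>\<close> to \<open>\<mu>\<close> while preserving
  \<open>\<lambda>\<^sup>+\<close> forces \<open>cf \<lambda> = cf \<mu>\<close>, such antichains exist below every positive set on which
  \<open>cf (sup x) \<noteq> \<theta>\<close>. This leaves the points \<open>x\<close> with \<open>cf (sup x) = \<theta>\<close>. There, pressing
  down on an upper bound in \<open>x\<close> of the indices concerned reduces disjoint refinement to blocks
  of fewer than \<open>\<lambda>\<close> sets, for which an Ulam matrix suffices. If the sections
  \<open>{i. x \<in> A\<^sub>i}\<close> have size \<open>< \<theta>\<close>, one bound serves the whole section and the refinement is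
  disjoint. In general the bounds run through a cofinal subset of \<open>x\<close> of order type
  \<open>\<le> \<theta>\<close>, and the sections get order type \<open>\<le> \<theta>\<close>.
\<close>

subsection \<open>Well-orders and cardinals\<close>

lemma wo_rel_Card_order: "Card_order r \<Longrightarrow> wo_rel r"
  by (simp add: wo_rel_def card_order_on_def)

lemma card_of_subset_ordLeq: "A \<subseteq> B \<Longrightarrow> |B| \<le>o r \<Longrightarrow> |A| \<le>o r"
  by (meson card_of_mono1 ordLeq_transitive)

lemma card_of_under_ordLess:
  assumes r: "Card_order r" "infinite (Field r)" and a: "a \<in> Field r"
  shows "|under r a| <o r"
proof -
  obtain b where b: "b \<in> Field r" "a \<noteq> b" "(a, b) \<in> r"
    using infinite_Card_order_limit r a by metis
  have "under r a \<subseteq> underS r b"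
    using b wo_rel.TRANS[OF wo_rel_Card_order[OF r(1)]] wo_rel.ANTISYM[OF wo_rel_Card_order[OF r(1)]]
    unfolding under_def underS_def trans_def antisym_def by blast
  then show ?thesis
    using card_of_underS[OF r(1) b(1)] card_of_mono1 ordLeq_ordLess_trans by blast
qed

lemma card_of_Times_ordLess_infinite_Field:
  assumes r: "Card_order r" "infinite (Field r)" and "|A| <o r" "|B| <o r"
  shows "|A \<times> B| <o r"
proof -
  have AB: "|A <+> B| <o r"
    using assms card_of_Plus_ordLess_infinite_Field by blast
  show ?thesis
  proof (cases "finite (A <+> B)")
    case True
    then have "finite (A \<times> B)" by (simp add: finite_Plus_iff)
    then show ?thesis
      using r finite_ordLess_infinite[OF card_of_Well_order, of r "A \<times> B"]
      by (simp add: Field_card_of card_order_on_def)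
  next
    case False
    have "|A \<times> B| \<le>o |A <+> B|"
      using False by (intro card_of_Times_ordLeq_infinite_Field)
        (simp_all add: Field_card_of card_of_Plus1 card_of_Plus2 card_of_card_order_on)
    then show ?thesis using AB ordLeq_ordLess_trans by blast
  qed
qed

lemma well_order_least:
  assumes "Well_order r" "B \<subseteq> Field r" "b \<in> B"
  shows "\<exists>a\<in>B. \<forall>c\<in>B. (a, c) \<in> r"
proof -
  interpret wo_rel r using assms(1) by (simp add: wo_rel_def)
  show ?thesis using minim_in[of B] minim_least[of B] assms by blast
qed

text \<open>Recursion along a well-order of \<open>J\<close> of type \<open>|J|\<close>: the values
  chosen before \<open>i\<close> number at most \<open>|S|\<close>, so they cannot exhaust
  \<open>Q i\<close>.\<close>

lemma injective_choice:
  fixes J :: "'b set" and Q :: "'b \<Rightarrow> 'c set"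
  assumes S: "infinite S" and J: "|J| \<le>o |S|" and Q: "\<And>i. i \<in> J \<Longrightarrow> \<not> |Q i| \<le>o |S|"
  shows "\<exists>w. inj_on w J \<and> (\<forall>i\<in>J. w i \<in> Q i)"
proof -
  interpret wo_rel "|J|" by (simp add: wo_rel_def card_of_Well_order)
  have "\<exists>w. \<forall>i. i \<in> J \<longrightarrow> w i \<in> Q i - w ` underS i"
  proof (rule dependent_wf_choice[OF WF])
    fix f g :: "'b \<Rightarrow> 'c" and x r
    assume eq: "\<And>z. (z, x) \<in> |J| - Id \<Longrightarrow> f z = g z"
    have "f ` underS x = g ` underS x"
      by (rule image_cong) (auto simp: underS_def intro: eq)
    then show "(x \<in> J \<longrightarrow> r \<in> Q x - f ` underS x) = (x \<in> J \<longrightarrow> r \<in> Q x - g ` underS x)" by simp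
  next
    fix x and f :: "'b \<Rightarrow> 'c"
    have "underS x \<subseteq> J" using Order_Relation.underS_Field[of "|J|" x] by (simp add: Field_card_of)
    then have "|f ` underS x| \<le>o |S|"
      using J card_of_image card_of_mono1 ordLeq_transitive by metis
    then have "\<not> Q x \<subseteq> f ` underS x" if "x \<in> J"
      using Q[OF that] card_of_subset_ordLeq by blast
    then show "\<exists>r. x \<in> J \<longrightarrow> r \<in> Q x - f ` underS x" by blast
  qed
  then obtain w where w: "\<And>i. i \<in> J \<Longrightarrow> w i \<in> Q i - w ` underS i" by blast
  have "w i \<noteq> w j" if "i \<in> J" "j \<in> J" "i \<noteq> j" for i j
  proof -
    have "i \<in> underS j \<or> j \<in> underS i"
      using that TOTALS by (auto simp: underS_def Field_card_of)
    then show ?thesis using w that by (metis DiffD2 imageI)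
  qed
  then have "inj_on w J" by (meson inj_onI)
  then show ?thesis using w by blast
qed

section \<open>Cofinal subsets of an infinite cardinal\<close>

lemma cofinal_infinite:
  assumes r: "Card_order r" "infinite (Field r)" and K: "K \<subseteq> Field r" "cofinal K r"
  shows "infinite K"
proof
  assume fin: "finite K"
  have "|\<Union>k\<in>F. under r k| <o r" if "finite F" "F \<subseteq> Field r" for F
    using that
  proof (induction F rule: finite_induct)
    case empty
    show ?case using finite_ordLess_infinite[OF card_of_Well_order, of r "{}"] r
      by (simp add: Field_card_of card_order_on_def)
  next
    case (insert k F)
    then show ?case
      using card_of_Un_ordLess_infinite_Field[OF r(2,1) card_of_under_ordLess[OF r, of k]] by simp
  qed
  then have "|\<Union>k\<in>K. under r k| <o r" using fin K(1) by blast
  moreover have "Field r \<subseteq> (\<Union>k\<in>K. under r k)" using K(2) by (auto simp: cofinal_def under_def)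
  ultimately have "|Field r| <o r" using card_of_mono1 ordLeq_ordLess_trans by blast
  then show False using card_of_Field_ordIso[OF r(1)] not_ordLess_ordIso by blast
qed

text \<open>Makes the choice operator in \<open>cf\<close> meaningful: a least cardinal exists, and
  \<open>Field r\<close> itself is cofinal since an infinite cardinal has no greatest
  element.\<close>

lemma cf_witness:
  assumes "Card_order r" "infinite (Field r)"
  shows "\<exists>K\<subseteq>Field r. cofinal K r \<and> cf r = |K| \<and> (\<forall>L\<subseteq>Field r. cofinal L r \<longrightarrow> |K| \<le>o |L| )"
proof -
  let ?R = "{|K| | K. K \<subseteq> Field r \<and> cofinal K r}"
  have "cofinal (Field r) r"
    unfolding cofinal_def using infinite_Card_order_limit[OF assms] by blast
  then have "?R \<noteq> {}" by blast
  moreover have "\<forall>c\<in>?R. Card_order c" using card_of_Card_order by blast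
  ultimately have "\<exists>c\<in>?R. \<forall>c'\<in>?R. c \<le>o c'" by (rule exists_minim_Card_order)
  then obtain K where "K \<subseteq> Field r" "cofinal K r" "\<forall>L\<subseteq>Field r. cofinal L r \<longrightarrow> |K| \<le>o |L|"
    by blast
  then have "\<exists>c. \<exists>K\<subseteq>Field r. cofinal K r \<and> c = |K| \<and> (\<forall>L\<subseteq>Field r. cofinal L r \<longrightarrow> |K| \<le>o |L| )"
    by blast
  then show ?thesis unfolding cf_def by (rule someI_ex)
qed

section \<open>Order types of subsets of a cardinal\<close>

lemma Field_Restr_Card_order:
  assumes "Card_order r" "s \<subseteq> Field r"
  shows "Field (Restr r s) = s" "Well_order (Restr r s)"
  using assms well_order_on_Restr[of r s] well_order_on_Well_order[of s "Restr r s"]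
  by (auto simp: card_order_on_def)

text \<open>The order type of \<open>s\<close> is at least its cardinality, so an initial segment of
  \<open>s\<close> has type \<open>|K|\<close>. This turns a condition on order types into a bound
  on sizes.\<close>

lemma subset_of_order_type:
  assumes r: "Card_order r" and s: "s \<subseteq> Field r" and K: "|K| \<le>o |s|"
  shows "\<exists>z\<subseteq>s. Restr r z =o |K|"
proof -
  note F = Field_Restr_Card_order[OF r s]
  have "|s| \<le>o Restr r s" using card_of_least[of s "Restr r s"] F by simp
  then have "|K| \<le>o Restr r s" using K ordLeq_transitive by blast
  then consider "|K| <o Restr r s" | "|K| =o Restr r s" using ordLeq_iff_ordLess_or_ordIso by blast
  then show ?thesis
  proof cases
    case 1
    then obtain a where "|K| =o Restr (Restr r s) (underS (Restr r s) a)"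
      using ordLess_iff_ordIso_Restr[OF F(2) card_of_Well_order] by blast
    moreover have sub: "underS (Restr r s) a \<subseteq> s"
      using Order_Relation.underS_Field[of "Restr r s" a] F(1) by blast
    then have "Restr (Restr r s) (underS (Restr r s) a) = Restr r (underS (Restr r s) a)" by blast
    ultimately show ?thesis using sub ordIso_symmetric by metis
  next
    case 2
    then show ?thesis using ordIso_symmetric by blast
  qed
qed

text \<open>The point of \<open>z\<close> corresponding to the greatest element \<open>None\<close>
  has a copy of \<open>Field c\<close> below it.\<close>

lemma card_of_section:
  assumes r: "Card_order r" and z: "z \<subseteq> Field r" and iso: "Restr r z =o ord_succ c"
  shows "\<exists>j\<in>z. |Field c| \<le>o |{i \<in> underS r j. i \<in> z}|"
proof -
  have "ord_succ c =o Restr r z" using iso by (rule ordIso_symmetric)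
  then obtain f where f: "iso (ord_succ c) (Restr r z) f" and wo: "Well_order (ord_succ c)"
    by (auto simp: ordIso_def)
  let ?j = "f None"
  have N: "None \<in> Field (ord_succ c)" "\<And>a. a \<in> Field c \<Longrightarrow> (Some a, None) \<in> ord_succ c"
    by (auto simp: ord_succ_def Field_def)
  have fN: "?j \<in> z"
    using iso_Field[OF f] N(1) Field_Restr_Card_order(1)[OF r z] by blast
  have inj: "inj_on f (Field (ord_succ c))" using f by (auto simp: iso_def bij_betw_def)
  have S: "f (Some a) \<in> {i \<in> underS r ?j. i \<in> z}" if "a \<in> Field c" for a
  proof -
    have "(f (Some a), ?j) \<in> Restr r z" using iso_forward[OF _ f] N(2)[OF that] by blast
    moreover have "f (Some a) \<noteq> ?j"
      using inj N that by (metis FieldI1 inj_onD option.distinct(1))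
    ultimately show ?thesis by (auto simp: underS_def)
  qed
  have "inj_on (\<lambda>a. f (Some a)) (Field c)"
  proof (rule inj_onI)
    fix a b assume ab: "a \<in> Field c" "b \<in> Field c" "f (Some a) = f (Some b)"
    then have "Some a = Some b" using inj N(2) by (meson FieldI1 inj_onD)
    then show "a = b" by simp
  qed
  moreover have "(\<lambda>a. f (Some a)) ` Field c \<subseteq> {i \<in> underS r ?j. i \<in> z}" using S by blast
  ultimately have "|Field c| \<le>o |{i \<in> underS r ?j. i \<in> z}|" using card_of_ordLeq by blast
  then show ?thesis using fN by blast
qed

lemma two_elements:
  assumes r: "Card_order r" and z: "z \<subseteq> Field r" and iso: "Restr r z =o natLeq_on 2"
  shows "\<exists>i\<in>z. \<exists>j\<in>z. i \<noteq> j"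
proof -
  have "|z| =o |{x::nat. x < 2}|"
    using card_of_cong[OF iso] by (simp add: Field_Restr_Card_order[OF r z] Field_natLeq_on)
  then obtain f where f: "bij_betw f {x::nat. x < 2} z"
    using card_of_ordIso ordIso_symmetric by metis
  then have "f 0 \<in> z" "f 1 \<in> z" by (auto dest: bij_betwE)
  moreover have "f 0 \<noteq> f 1"
    using inj_onD[OF bij_betw_imp_inj_on[OF f], of 0 1] by auto
  ultimately show ?thesis by blast
qed

subsection \<open>Disjoint refinements\<close>

text \<open>Sizes below the successor of \<open>mu\<close> appear as \<open>\<le>o mu\<close>, and
  \<open>normal\<close> is closure under diagonal unions with \<open>hat\<close> unfolded.\<close>

locale small_normal_ideal =
  fixes mu :: "'b rel" and lam :: "'a rel" and Z :: "'a set set" and I :: "'a set set set"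
  assumes mu_Card: "Card_order mu" and mu_inf: "infinite (Field mu)"
    and lam_Card: "Card_order lam" and mu_less_lam: "mu <o lam"
    and Z_Field: "z \<in> Z \<Longrightarrow> z \<subseteq> Field lam" and Z_small: "z \<in> Z \<Longrightarrow> |z| \<le>o mu"
    and null_sub: "A \<in> I \<Longrightarrow> A \<subseteq> Z"
    and null_mono: "A \<in> I \<Longrightarrow> B \<subseteq> A \<Longrightarrow> B \<in> I"
    and null_Union: "S \<subseteq> I \<Longrightarrow> |S| \<le>o mu \<Longrightarrow> \<Union>S \<in> I"
    and fine: "v \<in> Field lam \<Longrightarrow> {z \<in> Z. v \<notin> z} \<in> I"
    and normal: "(\<And>v. v \<in> Field lam \<Longrightarrow> F v \<in> I) \<Longrightarrow> {z \<in> Z. \<exists>v\<in>z. z \<in> F v} \<in> I"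
begin

section \<open>Null and positive sets\<close>

abbreviation pos :: "'a set set \<Rightarrow> bool" where
  "pos A \<equiv> A \<in> positive_sets Z I"

sublocale L: wo_rel lam using lam_Card by (rule wo_rel_Card_order)
sublocale M: wo_rel mu using mu_Card by (rule wo_rel_Card_order)

lemma lam_inf: "infinite (Field lam)"
proof -
  have "|Field mu| \<le>o |Field lam|"
    using mu_less_lam ordLess_imp_ordLeq card_of_mono2 by blast
  then show ?thesis using mu_inf card_of_ordLeq_finite by blast
qed

lemma lam_refl: "v \<in> Field lam \<Longrightarrow> (v, v) \<in> lam"
  using L.REFL by (simp add: refl_on_def)

lemma lam_trans: "(a, b) \<in> lam \<Longrightarrow> (b, c) \<in> lam \<Longrightarrow> (a, c) \<in> lam"
  using L.TRANS by (meson transE)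

lemma lam_antisym: "(a, b) \<in> lam \<Longrightarrow> (b, a) \<in> lam \<Longrightarrow> a = b"
  using L.ANTISYM by (meson antisymD)

lemma pos_iff: "pos A \<longleftrightarrow> A \<subseteq> Z \<and> A \<notin> I"
  by (simp add: positive_sets_def)

lemma pos_mono: "pos A \<Longrightarrow> A \<subseteq> B \<Longrightarrow> B \<subseteq> Z \<Longrightarrow> pos B"
  using null_mono by (auto simp: pos_iff)

lemma null_UN:
  assumes "|T| \<le>o mu" "\<And>t. t \<in> T \<Longrightarrow> A t \<in> I"
  shows "(\<Union>t\<in>T. A t) \<in> I"
proof -
  have "|A ` T| \<le>o mu" using assms(1) card_of_image ordLeq_transitive by blast
  then show ?thesis using null_Union[of "A ` T"] assms(2) by blast
qed

lemma finite_ordLeq_mu: "finite F \<Longrightarrow> |F| \<le>o mu"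
  using mu_inf finite_ordLess_infinite[OF card_of_Well_order M.WELL, of F]
  by (simp add: Field_card_of ordLess_imp_ordLeq)

lemma null_empty: "{} \<in> I"
  using null_Union[of "{}"] by (simp add: finite_ordLeq_mu)

lemma null_Un: "A \<in> I \<Longrightarrow> B \<in> I \<Longrightarrow> A \<union> B \<in> I"
  using null_Union[of "{A, B}"] by (simp add: finite_ordLeq_mu)

lemma pos_nonempty: "pos A \<Longrightarrow> A \<noteq> {}"
  using null_empty by (auto simp: pos_iff)

lemma pos_Diff_null: "pos A \<Longrightarrow> N \<in> I \<Longrightarrow> pos (A - N)"
  using null_Un[of "A - N" N] null_mono[of "A - N \<union> N" A] by (auto simp: pos_iff)

lemma pos_not_subset_null: "pos A \<Longrightarrow> N \<in> I \<Longrightarrow> \<exists>x\<in>A. x \<notin> N"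
  using pos_Diff_null pos_nonempty by blast

text \<open>Pigeonhole from completeness: if all pieces \<open>A \<inter> B t\<close> were null, at
  most \<open>mu\<close> null sets together with \<open>N\<close> would cover
  \<open>A\<close>.\<close>

lemma pos_split_UN:
  assumes "pos A" "N \<in> I" "|T| \<le>o mu" "\<And>x. x \<in> A \<Longrightarrow> x \<notin> N \<Longrightarrow> \<exists>t\<in>T. x \<in> B t"
  shows "\<exists>t\<in>T. pos (A \<inter> B t)"
proof (rule ccontr)
  assume "\<not> ?thesis"
  then have "A \<inter> B t \<in> I" if "t \<in> T" for t using that assms(1) by (auto simp: pos_iff)
  then have "(\<Union>t\<in>T. A \<inter> B t) \<in> I" using null_UN[OF assms(3), of "\<lambda>t. A \<inter> B t"] by blast
  then have "(\<Union>t\<in>T. A \<inter> B t) \<union> N \<in> I" using null_Un assms(2) by blast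
  moreover have "A \<subseteq> (\<Union>t\<in>T. A \<inter> B t) \<union> N" using assms(4) by blast
  ultimately show False using assms(1) null_mono by (auto simp: pos_iff)
qed

lemma pos_Int_or_Diff: "pos A \<Longrightarrow> pos (A \<inter> B) \<or> pos (A - B)"
  using null_Un[of "A \<inter> B" "A - B"] by (auto simp: pos_iff Int_Diff_Un)

text \<open>Fodor's argument: were all fibres of \<open>q\<close> null, so would be their diagonal
  union, yet it covers \<open>A\<close> because \<open>q x \<in> x\<close>.\<close>

lemma pressing_down:
  assumes "pos A" "\<And>x. x \<in> A \<Longrightarrow> q x \<in> x"
  shows "\<exists>v\<in>Field lam. pos {x \<in> A. q x = v}"
proof (rule ccontr)
  assume "\<not> ?thesis"
  then have "{x \<in> A. q x = v} \<in> I" if "v \<in> Field lam" for v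
    using that assms(1) by (auto simp: pos_iff)
  then have "{z \<in> Z. \<exists>v\<in>z. z \<in> {x \<in> A. q x = v}} \<in> I" by (rule normal)
  moreover have "A \<subseteq> {z \<in> Z. \<exists>v\<in>z. z \<in> {x \<in> A. q x = v}}" using assms by (auto simp: pos_iff)
  ultimately show False using assms(1) null_mono by (auto simp: pos_iff)
qed

text \<open>The exceptional set is the diagonal union over \<open>v\<close> of the sets
  \<open>{z \<in> Z. h v \<notin> z}\<close>, which are null by \<open>fine\<close>.\<close>

lemma null_not_closed:
  assumes "\<And>v. v \<in> Field lam \<Longrightarrow> h v \<in> Field lam"
  shows "{z \<in> Z. \<exists>v\<in>z. h v \<notin> z} \<in> I"
proof -
  have "{z \<in> Z. \<exists>v\<in>z. z \<in> {z \<in> Z. h v \<notin> z}} \<in> I" by (rule normal) (simp add: assms fine)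
  then show ?thesis by (rule null_mono) blast
qed

section \<open>Disjoint refinements from matrices\<close>

definition disjointly_refinable :: "'a set \<Rightarrow> ('a \<Rightarrow> 'a set set) \<Rightarrow> bool" where
  "disjointly_refinable J A \<longleftrightarrow>
     (\<exists>B. (\<forall>i\<in>J. pos (B i) \<and> B i \<subseteq> A i) \<and> (\<forall>i\<in>J. \<forall>j\<in>J. i \<noteq> j \<longrightarrow> B i \<inter> B j = {}))"

lemma disjointly_refinable_mono:
  assumes "disjointly_refinable J A" "J' \<subseteq> J" "\<And>i. i \<in> J' \<Longrightarrow> A i \<subseteq> A' i"
  shows "disjointly_refinable J' A'"
proof -
  obtain B where "\<forall>i\<in>J. pos (B i) \<and> B i \<subseteq> A i" "\<forall>i\<in>J. \<forall>j\<in>J. i \<noteq> j \<longrightarrow> B i \<inter> B j = {}"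
    using assms(1) unfolding disjointly_refinable_def by blast
  then show ?thesis
    using assms(2,3) unfolding disjointly_refinable_def by (intro exI[of _ B]) blast
qed

text \<open>By normality a null set \<open>N i\<close> can collect every overlap of
  \<open>A i\<close> with some \<open>A j\<close> at points containing \<open>j\<close>, and also
  the points missing \<open>i\<close>. A point left in both reduced sets contains \<open>j\<close>,
  hence lies in \<open>N i\<close>.\<close>

lemma disjointly_refinable_if_almost_disjoint:
  assumes J: "J \<subseteq> Field lam" and pos: "\<And>i. i \<in> J \<Longrightarrow> pos (A i)"
    and null: "\<And>i j. i \<in> J \<Longrightarrow> j \<in> J \<Longrightarrow> i \<noteq> j \<Longrightarrow> A i \<inter> A j \<in> I"
  shows "disjointly_refinable J A"
proof -
  define N where "N i = {z \<in> Z. \<exists>j\<in>z. z \<in> (if j \<in> J \<and> j \<noteq> i then A i \<inter> A j else {})} \<union> {z \<in> Z. i \<notin> z}" for i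
  have N: "N i \<in> I" if "i \<in> J" for i
  proof -
    have "{z \<in> Z. \<exists>j\<in>z. z \<in> (if j \<in> J \<and> j \<noteq> i then A i \<inter> A j else {})} \<in> I"
      by (rule normal) (use that null in \<open>auto simp: null_empty\<close>)
    moreover have "{z \<in> Z. i \<notin> z} \<in> I" using that J fine by blast
    ultimately show ?thesis unfolding N_def by (rule null_Un)
  qed
  let ?B = "\<lambda>i. A i - N i"
  have "pos (?B i)" if "i \<in> J" for i using pos_Diff_null[OF pos[OF that] N[OF that]] .
  moreover have "?B i \<inter> ?B j = {}" if ij: "i \<in> J" "j \<in> J" "i \<noteq> j" for i j
  proof -
    have "A i \<subseteq> Z" using pos ij by (auto simp: pos_iff)
    then show ?thesis using ij unfolding N_def by auto
  qed
  ultimately show ?thesis unfolding disjointly_refinable_def by (intro exI[of _ ?B]) auto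
qed

text \<open>
  For each \<open>i\<close> only the least row meeting \<open>A i\<close> in more than \<open>|S|\<close> sets is used. The earlier
  rows meet \<open>A i\<close> in few sets, and the sets with larger least row avoid choosing among them.
\<close>

lemma disjointly_refinable_matrix:
  fixes R :: "'r rel" and E :: "'r \<Rightarrow> 'a set set set"
  assumes R: "Well_order R" and J: "J \<subseteq> Field lam" and S: "infinite S" and JS: "|J| \<le>o |S|"
    and pos: "\<And>i. i \<in> J \<Longrightarrow> pos (A i)"
    and null: "\<And>r w w'. r \<in> Field R \<Longrightarrow> w \<in> E r \<Longrightarrow> w' \<in> E r \<Longrightarrow> w \<noteq> w' \<Longrightarrow> w \<inter> w' \<in> I"
    and rich: "\<And>i. i \<in> J \<Longrightarrow> \<exists>r\<in>Field R. \<not> |{w \<in> E r. pos (A i \<inter> w)}| \<le>o |S|"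
  shows "disjointly_refinable J A"
proof -
  define D where "D r i = {w \<in> E r. pos (A i \<inter> w)}" for r i
  interpret R: wo_rel R using R by (simp add: wo_rel_def)
  have "\<exists>r. r \<in> Field R \<and> \<not> |D r i| \<le>o |S| \<and> (\<forall>r'. (r', r) \<in> R - Id \<longrightarrow> |D r' i| \<le>o |S| )"
    if iJ: "i \<in> J" for i
  proof -
    let ?B = "{r \<in> Field R. \<not> |D r i| \<le>o |S|}"
    obtain b where "b \<in> ?B" using rich[OF iJ] unfolding D_def by blast
    then have "\<exists>a\<in>?B. \<forall>c\<in>?B. (a, c) \<in> R" by (intro well_order_least[OF R, of _ b]) auto
    then obtain r where r: "r \<in> Field R" "\<not> |D r i| \<le>o |S|"
      and least: "\<And>c. c \<in> Field R \<Longrightarrow> \<not> |D c i| \<le>o |S| \<Longrightarrow> (r, c) \<in> R" by blast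
    have "|D r' i| \<le>o |S|" if r': "(r', r) \<in> R - Id" for r'
    proof (rule ccontr)
      assume "\<not> |D r' i| \<le>o |S|"
      moreover have "r' \<in> Field R" using r' by (auto simp: Field_def)
      ultimately have "(r, r') \<in> R" using least by blast
      then show False using r' R.ANTISYM by (auto dest: antisymD)
    qed
    then show ?thesis using r by blast
  qed
  then obtain n where n: "\<And>i. i \<in> J \<Longrightarrow> n i \<in> Field R" "\<And>i. i \<in> J \<Longrightarrow> \<not> |D (n i) i| \<le>o |S|"
    "\<And>i r. i \<in> J \<Longrightarrow> (r, n i) \<in> R - Id \<Longrightarrow> |D r i| \<le>o |S|" by metis
  \<comment> \<open>Drop every set that is still positive on some \<open>A j\<close> with a later
    row. Minimality of \<open>n j\<close> bounds each loss by \<open>|S|\<close>, and there are at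
    most \<open>|J|\<close> losses.\<close>
  define Q where "Q i = D (n i) i - (\<Union>j\<in>{j \<in> J. (n i, n j) \<in> R - Id}. D (n i) j)" for i
  have "\<not> |Q i| \<le>o |S|" if i: "i \<in> J" for i
  proof
    assume "|Q i| \<le>o |S|"
    moreover have "|\<Union>j\<in>{j \<in> J. (n i, n j) \<in> R - Id}. D (n i) j| \<le>o |S|"
      using n(3) JS by (intro card_of_UNION_ordLeq_infinite[OF S]) (auto intro: card_of_subset_ordLeq)
    ultimately have "|Q i \<union> (\<Union>j\<in>{j \<in> J. (n i, n j) \<in> R - Id}. D (n i) j)| \<le>o |S|"
      using S by (intro card_of_Un_ordLeq_infinite_Field)
        (simp_all add: Field_card_of card_of_card_order_on)
    then have "|D (n i) i| \<le>o |S|" by (rule card_of_subset_ordLeq[rotated]) (auto simp: Q_def)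
    then show False using n(2) i by blast
  qed
  then obtain w where w: "inj_on w J" "\<And>i. i \<in> J \<Longrightarrow> w i \<in> Q i"
    using injective_choice[OF S JS, of Q] by blast
  have wD: "w i \<in> D (n i) i" if "i \<in> J" for i using w(2)[OF that] by (simp add: Q_def)
  have less: "A i \<inter> w i \<inter> (A j \<inter> w j) \<in> I" if ij: "i \<in> J" "j \<in> J" "(n i, n j) \<in> R - Id" for i j
  proof -
    have "w i \<notin> D (n i) j" using w(2)[of i] ij by (auto simp: Q_def)
    then have "\<not> pos (A j \<inter> w i)" using wD[OF ij(1)] by (simp add: D_def)
    then have "A j \<inter> w i \<in> I" using pos[OF ij(2)] by (auto simp: pos_iff)
    then show ?thesis by (rule null_mono) blast
  qed
  have "disjointly_refinable J (\<lambda>i. A i \<inter> w i)"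
  proof (rule disjointly_refinable_if_almost_disjoint[OF J])
    show "pos (A i \<inter> w i)" if "i \<in> J" for i using wD[OF that] by (simp add: D_def)
    show "A i \<inter> w i \<inter> (A j \<inter> w j) \<in> I" if ij: "i \<in> J" "j \<in> J" "i \<noteq> j" for i j
    proof -
      consider "n i = n j" | "(n i, n j) \<in> R - Id" | "(n j, n i) \<in> R - Id"
        using R.TOTALS n(1)[OF ij(1)] n(1)[OF ij(2)] by (metis DiffI pair_in_Id_conv)
      then show ?thesis
      proof cases
        case 1
        have "w i \<noteq> w j" using w(1) ij by (auto dest: inj_onD)
        then have "w i \<inter> w j \<in> I"
          using null[of "n i" "w i" "w j"] n(1)[OF ij(1)] wD[OF ij(1)] wD[OF ij(2)] 1
          by (simp add: D_def)
        then show ?thesis by (rule null_mono) blast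
      next
        case 2 then show ?thesis using less ij by blast
      next
        case 3 then show ?thesis using less[of j i] ij by (simp add: Int_commute)
      qed
    qed
  qed
  then show ?thesis by (rule disjointly_refinable_mono) auto
qed

lemma enumeration: "\<exists>f. \<forall>x\<in>Z. inj_on (f x) x \<and> f x ` x \<subseteq> Field mu"
proof -
  have "\<exists>g. inj_on g x \<and> g ` x \<subseteq> Field mu" if "x \<in> Z" for x
  proof -
    have "|x| \<le>o |Field mu|"
      using Z_small[OF that] card_of_Field_ordIso[OF mu_Card] ordIso_symmetric ordLeq_ordIso_trans
      by blast
    then show ?thesis by (simp add: card_of_ordLeq)
  qed
  then show ?thesis by metis
qed

lemma card_of_Field_mu: "|Field mu| \<le>o mu"
  using card_of_Field_ordIso[OF mu_Card] ordIso_imp_ordLeq by blast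

text \<open>Ulam matrix: \<open>e n v\<close> holds the \<open>x\<close> in which \<open>v\<close>
  has number \<open>n\<close>. Rows are disjoint since enumerations are injective, and by
  completeness each column \<open>v\<close> meets \<open>A i\<close> positively in some row. As
  \<open>lam\<close> columns are spread over \<open>mu\<close> rows, some row has more than
  \<open>|J|\<close> plus \<open>mu\<close> sets positive on \<open>A i\<close>.\<close>

lemma disjointly_refinable_small:
  assumes J: "J \<subseteq> Field lam" "|J| <o lam" and pos: "\<And>i. i \<in> J \<Longrightarrow> pos (A i)"
  shows "disjointly_refinable J A"
proof -
  obtain f where f: "\<And>x. x \<in> Z \<Longrightarrow> inj_on (f x) x" "\<And>x. x \<in> Z \<Longrightarrow> f x ` x \<subseteq> Field mu"
    using enumeration by blast
  define e where "e n v = {x \<in> Z. v \<in> x \<and> f x v = n}" for n v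
  have e_disj: "e n v \<inter> e n v' = {}" if "v \<noteq> v'" for n v v'
    using f(1) that by (auto simp: e_def dest: inj_onD)
  let ?S = "J <+> Field mu"
  have S: "infinite ?S" using mu_inf by (simp add: finite_Plus_iff)
  have "|Field mu| <o lam"
    using card_of_Field_mu mu_less_lam ordLeq_ordLess_trans by blast
  then have S_lam: "|?S| <o lam"
    using card_of_Plus_ordLess_infinite_Field lam_inf lam_Card J(2) by blast
  show ?thesis
  proof (rule disjointly_refinable_matrix[where R = mu and E = "\<lambda>n. e n ` Field lam"])
    show "Well_order mu" by (rule M.WELL)
    show "infinite ?S" by (rule S)
    show "|J| \<le>o |?S|" by (rule card_of_Plus1)
    show "w \<inter> w' \<in> I" if w: "w \<in> e n ` Field lam" "w' \<in> e n ` Field lam" "w \<noteq> w'" for n w w'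
    proof -
      obtain v v' where "w = e n v" "w' = e n v'" using w by blast
      then show ?thesis using e_disj[of v v' n] w(3) null_empty by metis
    qed
    show "\<exists>n\<in>Field mu. \<not> |{w \<in> e n ` Field lam. pos (A i \<inter> w)}| \<le>o |?S|" if i: "i \<in> J" for i
    proof (rule ccontr)
      define D where "D n = {w \<in> e n ` Field lam. pos (A i \<inter> w)}" for n
      assume "\<not> ?thesis"
      then have "|D n| \<le>o |?S|" if "n \<in> Field mu" for n using that by (auto simp: D_def)
      then have Sig: "|SIGMA n : Field mu. D n| \<le>o |?S|"
        using S card_of_Plus2 by (intro card_of_Sigma_ordLeq_infinite) auto
      have "\<exists>n\<in>Field mu. pos (A i \<inter> e n v)" if v: "v \<in> Field lam" for v
      proof (rule pos_split_UN[OF pos[OF i] fine[OF v] card_of_Field_mu])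
        fix x assume "x \<in> A i" "x \<notin> {z \<in> Z. v \<notin> z}"
        then have x: "x \<in> Z" "v \<in> x" using pos[OF i] by (auto simp: pos_iff)
        then have "f x v \<in> Field mu" "x \<in> e (f x v) v" using f(2) by (auto simp: e_def)
        then show "\<exists>n\<in>Field mu. x \<in> e n v" by blast
      qed
      then obtain n where n: "\<And>v. v \<in> Field lam \<Longrightarrow> n v \<in> Field mu \<and> pos (A i \<inter> e (n v) v)" by metis
      let ?h = "\<lambda>v. (n v, e (n v) v)"
      \<comment> \<open>A nonempty \<open>e n v\<close> determines \<open>v\<close>, because it is
        disjoint from the other sets of its row.\<close>
      have "inj_on ?h (Field lam)"
      proof (rule inj_onI)
        fix v v' assume v: "v \<in> Field lam" "v' \<in> Field lam" "?h v = ?h v'"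
        have "e (n v) v \<noteq> {}" using n[OF v(1)] pos_nonempty by blast
        then show "v = v'" using e_disj[of v v' "n v"] v(3) by auto
      qed
      moreover have "?h ` Field lam \<subseteq> (SIGMA n : Field mu. D n)" using n by (auto simp: D_def)
      ultimately have "|Field lam| \<le>o |SIGMA n : Field mu. D n|"
        using card_of_ordLeq by blast
      then have "|Field lam| \<le>o |?S|" using Sig ordLeq_transitive by blast
      then have "|Field lam| <o lam" using S_lam ordLeq_ordLess_trans by blast
      then show False using card_of_Field_ordIso[OF lam_Card] not_ordLess_ordIso by blast
    qed
  qed (use J(1) pos in \<open>blast+\<close>)
qed

text \<open>Pressing down makes the bound \<open>q i\<close> constant on a positive part of
  \<open>A i\<close>. Indices with the same value \<open>u\<close> lie at or below \<open>u\<close>,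
  so they are fewer than \<open>lam\<close> and \<open>disjointly_refinable_small\<close> applies to
  each block.\<close>

lemma refine_constant_bound:
  assumes J: "J \<subseteq> Field lam" and pos: "\<And>i. i \<in> J \<Longrightarrow> pos (A i)"
    and q: "\<And>i x. i \<in> J \<Longrightarrow> x \<in> A i \<Longrightarrow> q i x \<in> x \<and> (i, q i x) \<in> lam"
  shows "\<exists>B v. (\<forall>i\<in>J. pos (B i) \<and> B i \<subseteq> A i \<and> (\<forall>x\<in>B i. q i x = v i)) \<and>
    (\<forall>i\<in>J. \<forall>j\<in>J. i \<noteq> j \<longrightarrow> v i = v j \<longrightarrow> B i \<inter> B j = {})"
proof -
  have "\<exists>v. v \<in> Field lam \<and> pos {x \<in> A i. q i x = v}" if "i \<in> J" for i
    using pressing_down[OF pos[OF that], of "q i"] q that by blast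
  then obtain v where v: "\<And>i. i \<in> J \<Longrightarrow> v i \<in> Field lam"
    "\<And>i. i \<in> J \<Longrightarrow> pos {x \<in> A i. q i x = v i}" by metis
  have "disjointly_refinable {i \<in> J. v i = u} (\<lambda>i. {x \<in> A i. q i x = u})" if u: "u \<in> Field lam" for u
  proof (rule disjointly_refinable_small)
    have "(i, u) \<in> lam" if i: "i \<in> J" "v i = u" for i
    proof -
      obtain x where x: "x \<in> A i" "q i x = v i" using pos_nonempty[OF v(2)[OF i(1)]] by blast
      then show ?thesis using q[OF i(1) x(1)] i(2) by simp
    qed
    then have "{i \<in> J. v i = u} \<subseteq> under lam u" by (auto simp: under_def)
    then show "|{i \<in> J. v i = u}| <o lam"
      using card_of_under_ordLess[OF lam_Card lam_inf u] card_of_mono1 ordLeq_ordLess_trans by blast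
  qed (use J v in auto)
  then have "\<forall>u. \<exists>B. u \<in> Field lam \<longrightarrow>
      (\<forall>i\<in>{i \<in> J. v i = u}. pos (B i) \<and> B i \<subseteq> {x \<in> A i. q i x = u}) \<and>
      (\<forall>i\<in>{i \<in> J. v i = u}. \<forall>j\<in>{i \<in> J. v i = u}. i \<noteq> j \<longrightarrow> B i \<inter> B j = {})"
    unfolding disjointly_refinable_def by blast
  from choice[OF this] obtain B where B: "\<And>u. u \<in> Field lam \<Longrightarrow>
      (\<forall>i\<in>{i \<in> J. v i = u}. pos (B u i) \<and> B u i \<subseteq> {x \<in> A i. q i x = u}) \<and>
      (\<forall>i\<in>{i \<in> J. v i = u}. \<forall>j\<in>{i \<in> J. v i = u}. i \<noteq> j \<longrightarrow> B u i \<inter> B u j = {})"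
    by blast
  let ?B = "\<lambda>i. B (v i) i"
  have "pos (?B i) \<and> ?B i \<subseteq> A i \<and> (\<forall>x\<in>?B i. q i x = v i)" if "i \<in> J" for i
    using B[OF v(1)[OF that]] that by blast
  moreover have "?B i \<inter> ?B j = {}" if "i \<in> J" "j \<in> J" "i \<noteq> j" "v i = v j" for i j
    using B[OF v(1)[OF that(1)]] that by (metis (mono_tags, lifting) mem_Collect_eq)
  ultimately show ?thesis by (intro exI[of _ ?B] exI[of _ v]) (simp add: Ball_def)
qed

section \<open>Antichains of positive sets\<close>

definition antichain :: "'a set set \<Rightarrow> 'a set set set \<Rightarrow> bool" where
  "antichain A W \<longleftrightarrow> (\<forall>w\<in>W. pos w \<and> w \<subseteq> A) \<and> (\<forall>w\<in>W. \<forall>w'\<in>W. w \<noteq> w' \<longrightarrow> w \<inter> w' \<in> I)"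

text \<open>Zorn's lemma: a positive \<open>A'\<close> almost disjoint from all of \<open>W\<close>
  would contain, by density, a further set satisfying \<open>P\<close> that extends
  \<open>W\<close>.\<close>

lemma maximal_antichain:
  assumes dense: "\<And>A'. pos A' \<Longrightarrow> A' \<subseteq> A \<Longrightarrow> \<exists>w. pos w \<and> w \<subseteq> A' \<and> P w"
  shows "\<exists>W. antichain A W \<and> (\<forall>w\<in>W. P w) \<and> (\<forall>A'. pos A' \<longrightarrow> A' \<subseteq> A \<longrightarrow> (\<exists>w\<in>W. pos (A' \<inter> w)))"
proof -
  let ?A = "{W. antichain A W \<and> (\<forall>w\<in>W. P w)}"
  have "\<exists>M\<in>?A. \<forall>X\<in>?A. M \<subseteq> X \<longrightarrow> X = M"
  proof (rule subset_Zorn')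
    fix \<C> assume ch: "subset.chain ?A \<C>"
    have mem: "w \<in> \<Union>\<C> \<Longrightarrow> pos w \<and> w \<subseteq> A \<and> P w" for w
      using ch unfolding subset_chain_def antichain_def by blast
    have "w \<inter> w' \<in> I" if w: "w \<in> \<Union>\<C>" "w' \<in> \<Union>\<C>" "w \<noteq> w'" for w w'
    proof -
      obtain W W' where W: "W \<in> \<C>" "w \<in> W" "W' \<in> \<C>" "w' \<in> W'" using w by blast
      then have "W \<subseteq> W' \<or> W' \<subseteq> W" using ch unfolding subset_chain_def by blast
      then obtain V where "V \<in> \<C>" "w \<in> V" "w' \<in> V" using W by blast
      then show ?thesis using ch w(3) unfolding subset_chain_def antichain_def by blast
    qed
    then show "\<Union>\<C> \<in> ?A" using mem unfolding antichain_def by blast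
  qed
  then obtain W where "W \<in> ?A" and max: "\<forall>X\<in>?A. W \<subseteq> X \<longrightarrow> X = W" by (rule bexE)
  then have W: "antichain A W" "\<forall>w\<in>W. P w" by simp_all
  have "\<exists>w\<in>W. pos (A' \<inter> w)" if A': "pos A'" "A' \<subseteq> A" for A'
  proof (rule ccontr)
    assume "\<not> ?thesis"
    then have null: "A' \<inter> w \<in> I" if "w \<in> W" for w using that A' by (auto simp: pos_iff)
    obtain v where v: "pos v" "v \<subseteq> A'" "P v" using dense[OF A'] by blast
    have null': "v \<inter> w \<in> I \<and> w \<inter> v \<in> I" if "w \<in> W" for w
    proof -
      have "v \<inter> w \<subseteq> A' \<inter> w" using v(2) by blast
      then have "v \<inter> w \<in> I" by (rule null_mono[OF null[OF that]])
      then show ?thesis by (simp add: Int_commute)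
    qed
    then have "antichain A (insert v W)"
      using W(1) v A' unfolding antichain_def by auto
    then have "insert v W = W" using max W(2) v(3) by simp blast
    then have "v \<in> W" by blast
    then show False using null'[of v] v(1) by (simp add: pos_iff)
  qed
  then show ?thesis using W by blast
qed

text \<open>The antichains serve as the rows of a matrix: members of \<open>W i\<close> are positive
  subsets of \<open>A i\<close>, so row \<open>i\<close> has more than \<open>lam\<close> sets
  positive on \<open>A i\<close>.\<close>

lemma disjointly_refinable_if_large_antichains:
  assumes J: "J \<subseteq> Field lam" and pos: "\<And>i. i \<in> J \<Longrightarrow> pos (A i)"
    and W: "\<And>i. i \<in> J \<Longrightarrow> \<exists>W. antichain (A i) W \<and> \<not> |W| \<le>o lam"
  shows "disjointly_refinable J A"
proof -
  obtain W where W: "\<And>i. i \<in> J \<Longrightarrow> antichain (A i) (W i)" "\<And>i. i \<in> J \<Longrightarrow> \<not> |W i| \<le>o lam"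
    using W by metis
  let ?E = "\<lambda>i. if i \<in> J then W i else {}"
  show ?thesis
  proof (rule disjointly_refinable_matrix[where R = lam and E = ?E and S = "Field lam"])
    show "\<exists>r\<in>Field lam. \<not> |{w \<in> ?E r. pos (A i \<inter> w)}| \<le>o |Field lam|" if i: "i \<in> J" for i
    proof -
      have "{w \<in> ?E i. pos (A i \<inter> w)} = W i"
        using i W(1)[OF i] unfolding antichain_def by (auto simp: Int_absorb1)
      then have "\<not> |{w \<in> ?E i. pos (A i \<inter> w)}| \<le>o |Field lam|"
        using W(2)[OF i] card_of_Field_ordIso[OF lam_Card] ordLeq_ordIso_trans by auto
      then show ?thesis using i J by blast
    qed
    show "w \<inter> w' \<in> I" if "w \<in> ?E r" "w' \<in> ?E r" "w \<noteq> w'" for r w w'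
      using that W(1) unfolding antichain_def by (auto split: if_splits)
  qed (use J pos lam_inf L.WELL card_of_mono1 in auto)
qed

subsection \<open>Large antichains\<close>

text \<open>
  Functions \<open>g\<close> with \<open>|g v| \<le> |v|\<close> on a final segment \<open>big\<close> of \<open>lam\<close>: any \<open>lam\<close> many of them have
  an upper bound modulo bounded sets, and any \<open>mu\<close> many have one everywhere on \<open>big\<close>. This
  holds for regular and singular \<open>lam\<close> alike.
\<close>

definition big :: "'a set" where
  "big = {v \<in> Field lam. mu \<le>o |under lam v| }"

definition slow :: "('a \<Rightarrow> 'a) \<Rightarrow> bool" where
  "slow g \<longleftrightarrow> (\<forall>v\<in>big. g v \<in> Field lam \<and> |under lam (g v)| \<le>o |under lam v| )"

section \<open>Bounds for slow functions\<close>

lemma big_nonempty: "\<exists>v. v \<in> big"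
proof -
  obtain a where a: "a \<in> Field lam" "mu =o Restr lam (underS lam a)"
    using mu_less_lam ordLess_iff_ordIso_Restr[OF L.WELL M.WELL] by blast
  have "|Field mu| =o |Field (Restr lam (underS lam a))|" using a(2) by (rule card_of_cong)
  moreover have "Field (Restr lam (underS lam a)) \<subseteq> under lam a"
    by (rule subset_trans[OF Field_Restr_subset underS_subset_under])
  ultimately have "|Field mu| \<le>o |under lam a|"
    using card_of_mono1 ordIso_ordLeq_trans by blast
  then have "mu \<le>o |under lam a|"
    using card_of_Field_ordIso[OF mu_Card] ordIso_symmetric ordIso_ordLeq_trans by blast
  then show ?thesis using a(1) by (auto simp: big_def)
qed

lemma big_mono: "v \<in> big \<Longrightarrow> (v, w) \<in> lam \<Longrightarrow> w \<in> big"
proof -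
  assume v: "v \<in> big" and vw: "(v, w) \<in> lam"
  have "under lam v \<subseteq> under lam w" using vw lam_trans by (auto simp: under_def)
  then have "|under lam v| \<le>o |under lam w|" by (rule card_of_mono1)
  then have "mu \<le>o |under lam w|" using v ordLeq_transitive unfolding big_def by blast
  then show "w \<in> big" using vw by (auto simp: big_def Field_def)
qed

lemma infinite_under_big: "v \<in> big \<Longrightarrow> infinite (under lam v)"
proof
  assume v: "v \<in> big" "finite (under lam v)"
  then have "|Field mu| \<le>o |under lam v|"
    using card_of_Field_mu ordLeq_transitive unfolding big_def by blast
  then show False using v(2) mu_inf card_of_ordLeq_finite by blast
qed

text \<open>Take the least \<open>u\<close> outside the union of the initial segments up to points
  of \<open>V\<close>. That union is no larger than \<open>under lam v\<close>, so \<open>u\<close>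
  exists and, by leastness, has few predecessors.\<close>

lemma strict_bound:
  assumes v: "v \<in> big" and V: "V \<subseteq> Field lam" "|V| \<le>o |under lam v|"
    and small: "\<And>w. w \<in> V \<Longrightarrow> |under lam w| \<le>o |under lam v|"
  shows "\<exists>u\<in>Field lam. |under lam u| \<le>o |under lam v| \<and> (\<forall>w\<in>V. (w, u) \<in> lam - Id)"
proof -
  let ?U = "\<Union>w\<in>V. under lam w"
  have inf: "infinite (under lam v)" using infinite_under_big[OF v] .
  have U: "|?U| \<le>o |under lam v|"
    using small by (intro card_of_UNION_ordLeq_infinite[OF inf V(2)]) blast
  have vlam: "v \<in> Field lam" using v by (simp add: big_def)
  have "|?U| <o lam"
    using U card_of_under_ordLess[OF lam_Card lam_inf vlam] ordLeq_ordLess_trans by blast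
  then have "\<not> Field lam \<subseteq> ?U"
    using card_of_Field_ordIso[OF lam_Card] card_of_mono1[of "Field lam" ?U]
      not_ordLess_ordIso ordLeq_ordLess_trans by blast
  then obtain b where "b \<in> Field lam - ?U" by blast
  then have "\<exists>a\<in>Field lam - ?U. \<forall>c\<in>Field lam - ?U. (a, c) \<in> lam"
    by (intro well_order_least[OF L.WELL, of _ b]) auto
  then obtain u where u: "u \<in> Field lam" "u \<notin> ?U"
    and least: "\<And>c. c \<in> Field lam \<Longrightarrow> c \<notin> ?U \<Longrightarrow> (u, c) \<in> lam" by blast
  have "under lam u \<subseteq> insert u ?U"
  proof
    fix a assume a: "a \<in> under lam u"
    then have "a \<in> Field lam" "(a, u) \<in> lam" by (auto simp: under_def Field_def)
    then show "a \<in> insert u ?U" using least[of a] lam_antisym[of a u] by blast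
  qed
  moreover have "|insert u ?U| \<le>o |under lam v|"
  proof -
    have "|{u}| \<le>o |under lam v|"
      using inf finite_ordLess_infinite[OF card_of_Well_order card_of_Well_order, of "{u}" "under lam v"]
      by (simp add: Field_card_of ordLess_imp_ordLeq)
    then have "|{u} \<union> ?U| \<le>o |under lam v|"
      using inf U by (intro card_of_Un_ordLeq_infinite_Field)
        (simp_all add: Field_card_of card_of_card_order_on)
    then show ?thesis by simp
  qed
  ultimately have "|under lam u| \<le>o |under lam v|" by (rule card_of_subset_ordLeq)
  moreover have "(w, u) \<in> lam - Id" if w: "w \<in> V" for w
  proof -
    have "u \<notin> under lam w" using u(2) w by blast
    then have uw: "(u, w) \<notin> lam" by (simp add: under_def)
    have wlam: "w \<in> Field lam" using w V(1) by blast
    then have "(w, u) \<in> lam" using uw u(1) L.TOTALS by blast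
    moreover have "w \<noteq> u" using uw lam_refl[OF wlam] by blast
    ultimately show ?thesis by simp
  qed
  ultimately show ?thesis using u(1) by blast
qed

lemma slow_strict_bound:
  assumes T: "\<And>v. v \<in> big \<Longrightarrow> |T v| \<le>o |under lam v|"
    and g: "\<And>v t. v \<in> big \<Longrightarrow> t \<in> T v \<Longrightarrow> slow (g t)"
  shows "\<exists>r. slow r \<and> (\<forall>v\<in>big. \<forall>t\<in>T v. (g t v, r v) \<in> lam - Id)"
proof -
  have "\<exists>u\<in>Field lam. |under lam u| \<le>o |under lam v| \<and> (\<forall>w\<in>(\<lambda>t. g t v) ` T v. (w, u) \<in> lam - Id)"
    if v: "v \<in> big" for v
  proof (rule strict_bound[OF v])
    show "|(\<lambda>t. g t v) ` T v| \<le>o |under lam v|"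
      using T[OF v] card_of_image ordLeq_transitive by blast
  qed (use g[OF v] v in \<open>auto simp: slow_def\<close>)
  then have "\<exists>r. \<forall>v\<in>big. r v \<in> Field lam \<and> |under lam (r v)| \<le>o |under lam v| \<and>
      (\<forall>t\<in>T v. (g t v, r v) \<in> lam - Id)"
    by (intro bchoice) auto
  then show ?thesis by (auto simp: slow_def)
qed

text \<open>The inequality is weak, unlike in \<open>cofinal\<close>, so a greatest element of
  \<open>x\<close> alone is cofinal in \<open>x\<close>.\<close>

definition cofinal_in :: "'a set \<Rightarrow> 'a set \<Rightarrow> bool" where
  "cofinal_in C x \<longleftrightarrow> (\<forall>v\<in>x. \<exists>c\<in>C. (v, c) \<in> lam)"

text \<open>Strict domination modulo a bounded set. The bound \<open>b\<close> is kept explicit so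
  that \<open>b \<in> x\<close> can be required of a single point \<open>x\<close>.\<close>

definition below_from :: "'a \<Rightarrow> ('a \<Rightarrow> 'a) \<Rightarrow> ('a \<Rightarrow> 'a) \<Rightarrow> bool" where
  "below_from b g h \<longleftrightarrow> (\<forall>v\<in>big. (b, v) \<in> lam \<longrightarrow> (g v, h v) \<in> lam - Id)"

lemma below_from_mono: "below_from b g h \<Longrightarrow> (b, c) \<in> lam \<Longrightarrow> below_from c g h"
  using lam_trans unfolding below_from_def by blast

text \<open>Diagonal bound: at \<open>v\<close> only the functions \<open>g t\<close> with
  \<open>t\<close> at or below \<open>v\<close> are dominated, few enough for
  \<open>slow_strict_bound\<close>.\<close>

lemma eventual_bound:
  assumes "\<And>t. t \<in> Field lam \<Longrightarrow> slow (g t)"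
  shows "\<exists>r. slow r \<and> (\<forall>t\<in>Field lam. below_from t (g t) r)"
proof -
  have "\<exists>r. slow r \<and> (\<forall>v\<in>big. \<forall>t\<in>under lam v. (g t v, r v) \<in> lam - Id)"
    using assms by (intro slow_strict_bound) (auto simp: under_def Field_def card_of_mono1)
  then show ?thesis by (auto simp: below_from_def under_def)
qed

lemma surj_from_Field_lam:
  assumes "|W| \<le>o lam" "W \<noteq> {}"
  shows "\<exists>h. h ` Field lam = W"
proof -
  have "|W| \<le>o |Field lam|"
    using assms(1) card_of_Field_ordIso[OF lam_Card] ordIso_symmetric ordLeq_ordIso_trans by blast
  then show ?thesis using card_of_ordLeq2[OF assms(2)] by blast
qed

lemma eventual_bound_set:
  assumes "|H| \<le>o lam" "\<And>h. h \<in> H \<Longrightarrow> slow h"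
  shows "\<exists>r. slow r \<and> (\<forall>h\<in>H. \<exists>b\<in>Field lam. below_from b h r)"
proof (cases "H = {}")
  case True
  \<comment> \<open>An empty \<open>H\<close> asks only for some slow function; the bound over empty
    index sets is one.\<close>
  show ?thesis using slow_strict_bound[of "\<lambda>_. {} :: 'a set" "\<lambda>_ v. v"] True by (auto simp: card_of_empty)
next
  case False
  then obtain e where e: "e ` Field lam = H" using surj_from_Field_lam assms(1) by blast
  then obtain r where "slow r" "\<forall>t\<in>Field lam. below_from t (e t) r"
    using eventual_bound[of e] assms(2) by blast
  then show ?thesis using e by blast
qed

text \<open>
  Enumerate each \<open>x\<close> by \<open>f x\<close> in type \<open>mu\<close>. Every slow \<open>g\<close> maps a cofinal part of \<open>C x\<close> below some
  \<open>k\<close>, that is, into a subset of \<open>x\<close> of size less than \<open>mu\<close>. If all antichains had size at most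
  \<open>lam\<close>, one \<open>k\<close> would work for cofinally many \<open>g\<close> below some \<open>A0\<close>, and almost every \<open>x \<in> A0\<close> would
  have such \<open>g\<close> between consecutive members of a \<open>mu\<close>-chain of slow functions. Evaluating these
  \<open>mu\<close> many \<open>g\<close> at points of \<open>C x\<close> gives an injection of \<open>mu\<close> into a product of two sets of
  size less than \<open>mu\<close>.
\<close>

lemma large_antichain:
  assumes A: "pos A"
    and C: "\<And>x. x \<in> A \<Longrightarrow> C x \<subseteq> x" and C_small: "\<And>x. x \<in> A \<Longrightarrow> |C x| <o mu"
    and pigeon: "\<And>x F. x \<in> A \<Longrightarrow> F ` C x \<subseteq> Field mu \<Longrightarrow>
      \<exists>k\<in>Field mu. cofinal_in {c \<in> C x. (F c, k) \<in> mu} x"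
    and f: "\<And>x. x \<in> Z \<Longrightarrow> inj_on (f x) x" "\<And>x. x \<in> Z \<Longrightarrow> f x ` x \<subseteq> Field mu"
  shows "\<exists>W. antichain A W \<and> \<not> |W| \<le>o lam"
proof (rule ccontr)
  assume "\<not> ?thesis"
  then have sat: "|W| \<le>o lam" if "antichain A W" for W using that by blast
  define S where "S g k = {x \<in> A. cofinal_in {c \<in> C x \<inter> big. g c \<in> x \<and> (f x (g c), k) \<in> mu} x}" for g k
  have AZ: "A \<subseteq> Z" using A by (simp add: pos_iff)
  have S_cover: "\<exists>k\<in>Field mu. pos (A' \<inter> S g k)" if A': "pos A'" "A' \<subseteq> A" and g: "slow g" for A' g
  proof -
    obtain b where b: "b \<in> big" using big_nonempty by blast
    \<comment> \<open>Off \<open>big\<close> nothing is known about \<open>g\<close>; the identity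
      there makes \<open>?h\<close> a map of \<open>Field lam\<close> into itself, so almost all
      \<open>x\<close> are closed under it.\<close>
    let ?h = "\<lambda>v. if v \<in> big then g v else v"
    let ?N = "{z \<in> Z. \<exists>v\<in>z. ?h v \<notin> z} \<union> {z \<in> Z. b \<notin> z}"
    have "?N \<in> I"
      using g b by (intro null_Un null_not_closed fine) (auto simp: slow_def big_def)
    then show ?thesis
    proof (rule pos_split_UN[OF A'(1) _ card_of_Field_mu])
      fix x assume x: "x \<in> A'" "x \<notin> ?N"
      then have xA: "x \<in> A" and xZ: "x \<in> Z" using A' AZ by auto
      have closed: "g v \<in> x" if "v \<in> x" "v \<in> big" for v using x(2) xZ that by force
      have bx: "b \<in> x" using x(2) xZ by blast
      have "(\<lambda>c. f x (?h c)) ` C x \<subseteq> Field mu"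
        using C[OF xA] f(2)[OF xZ] closed by (auto simp: subset_iff image_iff)
      from pigeon[OF xA this] obtain k where k: "k \<in> Field mu"
        "cofinal_in {c \<in> C x. (f x (?h c), k) \<in> mu} x" by blast
      have "cofinal_in {c \<in> C x \<inter> big. g c \<in> x \<and> (f x (g c), k) \<in> mu} x"
        unfolding cofinal_in_def
      proof
        fix v assume v: "v \<in> x"
        have "b \<in> Field lam" "v \<in> Field lam" using bx v Z_Field[OF xZ] by auto
        \<comment> \<open>The larger of \<open>b\<close> and \<open>v\<close>: points of
          \<open>C x\<close> beyond it lie in \<open>big\<close>, where \<open>?h\<close> agrees
          with \<open>g\<close>.\<close>
        then obtain u where u: "u \<in> x" "(b, u) \<in> lam" "(v, u) \<in> lam"
          using bx v L.TOTALS lam_refl by metis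
        then obtain c where c: "c \<in> C x" "(f x (?h c), k) \<in> mu" "(u, c) \<in> lam"
          using k(2) unfolding cofinal_in_def by blast
        have "c \<in> big" using big_mono[OF b] u(2) c(3) lam_trans by blast
        then show "\<exists>c\<in>{c \<in> C x \<inter> big. g c \<in> x \<and> (f x (g c), k) \<in> mu}. (v, c) \<in> lam"
          using c u(3) lam_trans closed C[OF xA] by (intro bexI[of _ c]) auto
      qed
      then show "\<exists>k\<in>Field mu. x \<in> S g k" using k(1) xA by (auto simp: S_def)
    qed
  qed
  \<comment> \<open>On every positive subset of \<open>A0\<close> the slow functions for which
    \<open>k\<close> works are to be cofinal under eventual domination.\<close>
  define G where "G k A0 \<longleftrightarrow> (\<forall>A' h. pos A' \<longrightarrow> A' \<subseteq> A0 \<longrightarrow> slow h \<longrightarrow>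
      (\<exists>g b. slow g \<and> b \<in> Field lam \<and> below_from b h g \<and> pos (A' \<inter> S g k)))" for k A0
  have "\<exists>k A0. pos A0 \<and> A0 \<subseteq> A \<and> G k A0"
  proof (rule ccontr)
    assume neg: "\<not> ?thesis"
    \<comment> \<open>If \<open>G\<close> always fails, each \<open>k\<close> has a maximal
      antichain of sets \<open>w\<close> with a witness \<open>h\<close> beyond which
      \<open>k\<close> works on no positive part of \<open>w\<close>. By \<open>sat\<close> there
      are at most \<open>lam\<close> witnesses in all, so some slow \<open>g\<close> is eventually
      above them, contradicting \<open>S_cover\<close>.\<close>
    define P where "P k A' h \<longleftrightarrow> slow h \<and>
      (\<forall>g b. slow g \<longrightarrow> b \<in> Field lam \<longrightarrow> below_from b h g \<longrightarrow> \<not> pos (A' \<inter> S g k))" for k A' h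
    have "\<exists>w. pos w \<and> w \<subseteq> A' \<and> (\<exists>h. P k w h)" if "pos A'" "A' \<subseteq> A" for k A'
    proof -
      have "\<not> G k A'" using neg that by simp
      then obtain w h where "pos w" "w \<subseteq> A'" "slow h"
        "\<not> (\<exists>g b. slow g \<and> b \<in> Field lam \<and> below_from b h g \<and> pos (w \<inter> S g k))"
        unfolding G_def by auto
      then show ?thesis unfolding P_def by (intro exI[of _ w] conjI exI[of _ h]) auto
    qed
    then have "\<exists>W. antichain A W \<and> (\<forall>w\<in>W. \<exists>h. P k w h) \<and>
        (\<forall>A'. pos A' \<longrightarrow> A' \<subseteq> A \<longrightarrow> (\<exists>w\<in>W. pos (A' \<inter> w)))" for k
      by (intro maximal_antichain) blast
    then obtain W where W: "\<And>k. antichain A (W k)" "\<And>k w. w \<in> W k \<Longrightarrow> \<exists>h. P k w h"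
      and max: "\<And>k A'. pos A' \<Longrightarrow> A' \<subseteq> A \<Longrightarrow> \<exists>w\<in>W k. pos (A' \<inter> w)" by metis
    define h where "h k w = (SOME h. P k w h)" for k w
    have h: "P k w (h k w)" if "w \<in> W k" for k w
      unfolding h_def using W(2)[OF that] by (rule someI_ex)
    let ?H = "\<Union>k\<in>Field mu. h k ` W k"
    have "|?H| \<le>o lam"
    proof (rule card_of_UNION_ordLeq_infinite_Field[OF lam_inf lam_Card])
      show "|Field mu| \<le>o lam"
        using card_of_Field_mu mu_less_lam ordLess_imp_ordLeq ordLeq_transitive by blast
      show "\<forall>k\<in>Field mu. |h k ` W k| \<le>o lam"
        using sat[OF W(1)] card_of_image ordLeq_transitive by blast
    qed
    moreover have "slow g" if "g \<in> ?H" for g using that h by (auto simp: P_def)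
    ultimately have "\<exists>g. slow g \<and> (\<forall>h\<in>?H. \<exists>b\<in>Field lam. below_from b h g)"
      by (rule eventual_bound_set)
    then obtain g where g: "slow g" "\<forall>h\<in>?H. \<exists>b\<in>Field lam. below_from b h g" by (elim exE conjE)
    obtain k where k: "k \<in> Field mu" "pos (A \<inter> S g k)" using S_cover[OF A subset_refl g(1)] by blast
    then obtain w where w: "w \<in> W k" "pos (A \<inter> S g k \<inter> w)"
      using max[OF k(2) Int_lower1, of k] by blast
    have "h k w \<in> ?H" using w(1) k(1) by blast
    then obtain b where b: "b \<in> Field lam" "below_from b (h k w) g" using g(2) by blast
    have "w \<subseteq> Z" using W(1)[of k] w(1) AZ unfolding antichain_def by blast
    then have "pos (w \<inter> S g k)" using w(2) by (elim pos_mono) auto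
    then show False using h[OF w(1)] b g(1) unfolding P_def by simp
  qed
  then obtain k A0 where A0: "pos A0" "A0 \<subseteq> A" and "G k A0" by (elim exE conjE)
  then have rich: "\<exists>g b. slow g \<and> b \<in> Field lam \<and> below_from b h g \<and> pos (A' \<inter> S g k)"
    if "pos A'" "A' \<subseteq> A0" "slow h" for A' h
    using that unfolding G_def by simp
  define bad where "bad h r = {x \<in> A0. \<not> (\<exists>g. \<exists>b\<in>x. x \<in> S g k \<and> below_from b h g \<and> below_from b g r)}" for h r
  \<comment> \<open>A maximal antichain of sets \<open>w \<subseteq> S g k\<close> with
    \<open>g\<close> eventually above \<open>h\<close> has at most \<open>lam\<close> members, so
    one \<open>r\<close> eventually bounds all these \<open>g\<close>. A point of the
    \<open>t\<close>-th member containing \<open>t\<close> and \<open>b t\<close> is not bad: use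
    the larger of the two.\<close>
  have step: "\<exists>r. slow r \<and> bad h r \<in> I" if h: "slow h" for h
  proof -
    define P where "P w g b \<longleftrightarrow> slow g \<and> b \<in> Field lam \<and> below_from b h g \<and> w \<subseteq> S g k" for w g b
    have "\<exists>w. pos w \<and> w \<subseteq> A' \<and> (\<exists>g b. P w g b)" if A': "pos A'" "A' \<subseteq> A0" for A'
    proof -
      obtain g b where "slow g" "b \<in> Field lam" "below_from b h g" "pos (A' \<inter> S g k)"
        using rich[OF A' h] by blast
      then show ?thesis unfolding P_def by (intro exI[of _ "A' \<inter> S g k"]) auto
    qed
    from maximal_antichain[of A0 "\<lambda>w. \<exists>g b. P w g b", OF this] obtain W where
      W: "antichain A0 W" "\<And>w. w \<in> W \<Longrightarrow> \<exists>g b. P w g b"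
      and max: "\<And>A'. pos A' \<Longrightarrow> A' \<subseteq> A0 \<Longrightarrow> \<exists>w\<in>W. pos (A' \<inter> w)" by blast
    have "antichain A W" using W(1) A0(2) unfolding antichain_def by blast
    then have "|W| \<le>o lam" by (rule sat)
    moreover have "W \<noteq> {}" using max[OF A0(1)] by blast
    ultimately obtain e where e: "e ` Field lam = W" using surj_from_Field_lam[of W] by blast
    have "\<exists>g b. P (e t) g b" if "t \<in> Field lam" for t
      using W(2)[of "e t"] e that by blast
    then obtain g b where gb: "\<And>t. t \<in> Field lam \<Longrightarrow> P (e t) (g t) (b t)" by metis
    then have "\<And>t. t \<in> Field lam \<Longrightarrow> slow (g t)" by (simp add: P_def)
    then obtain r where r: "slow r" "\<And>t. t \<in> Field lam \<Longrightarrow> below_from t (g t) r"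
      using eventual_bound[of g] by blast
    let ?N = "{z \<in> Z. \<exists>t\<in>z. b t \<notin> z}"
    have N: "?N \<in> I" using gb by (intro null_not_closed) (simp add: P_def)
    have ok: "x \<notin> bad h r" if x: "x \<in> A0" "x \<notin> ?N" "t \<in> x" "x \<in> e t" for x t
    proof -
      have xZ: "x \<in> Z" using x(1) A0(2) AZ by blast
      have t: "t \<in> Field lam" using x(3) Z_Field[OF xZ] by blast
      have bt: "b t \<in> x" using x xZ by blast
      obtain c where c: "c \<in> x" "(t, c) \<in> lam" "(b t, c) \<in> lam"
      proof -
        have btl: "b t \<in> Field lam" using bt Z_Field[OF xZ] by blast
        show ?thesis
          using that[of t] that[of "b t"] L.TOTALS bt btl x(3) t lam_refl[OF t] lam_refl[OF btl]
          by blast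
      qed
      have "below_from c h (g t)" "x \<in> S (g t) k"
        using gb[OF t] below_from_mono[OF _ c(3)] x(4) by (auto simp: P_def)
      moreover have "below_from c (g t) r" using below_from_mono[OF r(2)[OF t] c(2)] .
      ultimately show ?thesis using c(1) by (auto simp: bad_def)
    qed
    have "bad h r \<in> I"
    proof (rule ccontr)
      assume "bad h r \<notin> I"
      then have "pos (bad h r)" using A0(2) AZ by (auto simp: pos_iff bad_def)
      then have "pos (bad h r - ?N)" using N by (rule pos_Diff_null)
      then obtain w where w: "w \<in> W" "pos ((bad h r - ?N) \<inter> w)"
        using max[of "bad h r - ?N"] by (auto simp: bad_def)
      then obtain t where t: "t \<in> Field lam" "w = e t" using e by blast
      \<comment> \<open>\<open>ok\<close> needs \<open>t \<in> x\<close>, which fails only on a null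
        set.\<close>
      obtain x where x: "x \<in> (bad h r - ?N) \<inter> w" "x \<notin> {z \<in> Z. t \<notin> z}"
        using pos_not_subset_null[OF w(2) fine[OF t(1)]] by blast
      then have "x \<in> A0" "x \<in> Z" using A0(2) AZ by (auto simp: bad_def)
      then show False using ok[of x t] x t(2) by blast
    qed
    then show ?thesis using r(1) by blast
  qed
  \<comment> \<open>The chain of length \<open>mu\<close>: \<open>u i\<close> comes from
    \<open>step\<close> for some \<open>h\<close> above all earlier \<open>u j\<close>. Slowness of
    these is a premise so that a value exists for arbitrary \<open>u\<close>; it is recovered by
    induction.\<close>
  define R where "R u i r \<longleftrightarrow> ((\<forall>j\<in>underS mu i. slow (u j)) \<longrightarrow> slow r \<and>
      (\<exists>h. (\<forall>j\<in>underS mu i. \<forall>v\<in>big. (u j v, h v) \<in> lam) \<and> bad h r \<in> I))" for u i r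
  have "\<exists>u. \<forall>i. R u i (u i)"
  proof (rule dependent_wf_choice[OF M.WF])
    fix u u' :: "'b \<Rightarrow> 'a \<Rightarrow> 'a" and i r
    assume "\<And>j. (j, i) \<in> mu - Id \<Longrightarrow> u j = u' j"
    then have "\<And>j. j \<in> underS mu i \<Longrightarrow> u j = u' j" by (simp add: underS_def)
    then show "R u i r = R u' i r" unfolding R_def by simp
  next
    fix i and u :: "'b \<Rightarrow> 'a \<Rightarrow> 'a"
    show "\<exists>r. R u i r"
    proof (cases "\<forall>j\<in>underS mu i. slow (u j)")
      case True
      have "\<exists>h. slow h \<and> (\<forall>v\<in>big. \<forall>j\<in>underS mu i. (u j v, h v) \<in> lam - Id)"
      proof (rule slow_strict_bound)
        fix v assume "v \<in> big"
        moreover have "|underS mu i| \<le>o mu"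
          using card_of_subset_ordLeq[OF Order_Relation.underS_Field card_of_Field_mu] .
        ultimately show "|underS mu i| \<le>o |under lam v|"
          unfolding big_def using ordLeq_transitive by blast
      qed (use True in blast)
      then obtain h where h: "slow h" "\<forall>v\<in>big. \<forall>j\<in>underS mu i. (u j v, h v) \<in> lam - Id" by blast
      obtain r where "slow r" "bad h r \<in> I" using step[OF h(1)] by blast
      then show ?thesis unfolding R_def using h(2) by blast
    qed (auto simp: R_def)
  qed
  then obtain u where u: "\<And>i. R u i (u i)" by blast
  have slow_u: "slow (u i)" for i
  proof (induction i rule: wf_induct_rule[OF M.WF])
    case (1 i)
    then have "\<forall>j\<in>underS mu i. slow (u j)" by (simp add: underS_def)
    then show ?case using u[of i] unfolding R_def by blast
  qed
  then have "\<exists>h. (\<forall>j\<in>underS mu i. \<forall>v\<in>big. (u j v, h v) \<in> lam) \<and> bad h (u i) \<in> I" for i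
    using u[of i] unfolding R_def by blast
  then obtain h where h: "\<And>i j v. j \<in> underS mu i \<Longrightarrow> v \<in> big \<Longrightarrow> (u j v, h i v) \<in> lam"
    and null: "\<And>i. bad (h i) (u i) \<in> I" by metis
  \<comment> \<open>Completeness lets a single \<open>x\<close> escape all \<open>mu\<close> many
    bad sets.\<close>
  have "(\<Union>i\<in>Field mu. bad (h i) (u i)) \<in> I"
    using null by (intro null_UN[OF card_of_Field_mu])
  then obtain x where x: "x \<in> A0" "\<And>i. i \<in> Field mu \<Longrightarrow> x \<notin> bad (h i) (u i)"
    using pos_not_subset_null[OF A0(1)] by blast
  have xA: "x \<in> A" and xZ: "x \<in> Z" using x(1) A0(2) AZ by auto
  have "\<exists>g c. c \<in> C x \<inter> big \<and> g c \<in> x \<and> (f x (g c), k) \<in> mu \<and>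
      (h i c, g c) \<in> lam - Id \<and> (g c, u i c) \<in> lam - Id" if i: "i \<in> Field mu" for i
  proof -
    obtain g b where gb: "b \<in> x" "x \<in> S g k" "below_from b (h i) g" "below_from b g (u i)"
      using x(2)[OF i] x(1) unfolding bad_def by blast
    then obtain c where "c \<in> C x \<inter> big" "g c \<in> x" "(f x (g c), k) \<in> mu" "(b, c) \<in> lam"
      unfolding S_def cofinal_in_def by blast
    then show ?thesis using gb(3,4) unfolding below_from_def by blast
  qed
  then obtain g c where gc: "\<And>i. i \<in> Field mu \<Longrightarrow> c i \<in> C x \<inter> big \<and> g i (c i) \<in> x \<and> (f x (g i (c i)), k) \<in> mu \<and>
      (h i (c i), g i (c i)) \<in> lam - Id \<and> (g i (c i), u i (c i)) \<in> lam - Id" by metis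
  \<comment> \<open>At a common point \<open>c j = c i\<close> the values satisfy
    \<open>g j < u j \<le> h i < g i\<close>.\<close>
  have increasing: "(g j (c j), g i (c i)) \<in> lam - Id"
    if i: "i \<in> Field mu" and j: "j \<in> underS mu i" and eq: "c j = c i" for i j
  proof -
    have "j \<in> Field mu" using j Order_Relation.underS_Field[of mu i] by blast
    then have "(g j (c j), u j (c j)) \<in> lam - Id" using gc by blast
    moreover have "(u j (c i), h i (c i)) \<in> lam" using h[OF j] gc[OF i] by blast
    moreover have "(h i (c i), g i (c i)) \<in> lam - Id" using gc[OF i] by blast
    ultimately show ?thesis using eq lam_trans lam_antisym by (metis Diff_iff pair_in_Id_conv)
  qed
  \<comment> \<open>The second coordinate separates indices with the same \<open>c\<close> and is at
    most \<open>k\<close>, so \<open>mu\<close> would embed into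
    \<open>C x \<times> under mu k\<close>.\<close>
  let ?F = "\<lambda>i. (c i, f x (g i (c i)))"
  have "inj_on ?F (Field mu)"
  proof (rule inj_onI)
    fix i j assume ij: "i \<in> Field mu" "j \<in> Field mu" "?F i = ?F j"
    from ij(3) have ceq: "c i = c j" by (rule Pair_inject)
    from ij(3) have "f x (g i (c i)) = f x (g j (c j))" by (rule Pair_inject)
    then have "g i (c i) = g j (c j)"
      using inj_onD[OF f(1)[OF xZ]] gc[OF ij(1)] gc[OF ij(2)] by blast
    then have "i \<notin> underS mu j" "j \<notin> underS mu i"
      
      using increasing[OF ij(2) _ ceq] increasing[OF ij(1) _ ceq[symmetric]] by auto
    then show "i = j" using M.TOTALS ij(1,2) by (auto simp: underS_def)
  qed
  moreover have "?F ` Field mu \<subseteq> C x \<times> under mu k" using gc by (auto simp: under_def)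
  ultimately have "|Field mu| \<le>o |C x \<times> under mu k|" using card_of_ordLeq by blast
  moreover have "|C x \<times> under mu k| <o mu"
  proof (rule card_of_Times_ordLess_infinite_Field[OF mu_Card mu_inf C_small[OF xA]])
    obtain i where "i \<in> Field mu" using mu_inf by fastforce
    then have "k \<in> Field mu" using gc by (auto simp: Field_def)
    then show "|under mu k| <o mu" by (rule card_of_under_ordLess[OF mu_Card mu_inf])
  qed
  ultimately have "|Field mu| <o mu" using ordLeq_ordLess_trans by blast
  then show False using card_of_Field_ordIso[OF mu_Card] not_ordLess_ordIso by blast
qed

end

subsection \<open>Small sections\<close>

text \<open>\<open>|K|\<close> represents \<theta>, so that no choice operator enters the
  arguments.\<close>

locale small_normal_ideal_cf = small_normal_ideal mu lam Z I
  for mu :: "'b rel" and lam :: "'a rel" and Z :: "'a set set" and I :: "'a set set set" +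
  fixes K :: "'b set"
  assumes K_Field: "K \<subseteq> Field mu" and K_cofinal: "cofinal K mu"
    and K_least: "L \<subseteq> Field mu \<Longrightarrow> cofinal L mu \<Longrightarrow> |K| \<le>o |L|"
begin

section \<open>Large antichains on points of cofinality other than \<theta>\<close>

lemma K_bound: "a \<in> Field mu \<Longrightarrow> \<exists>k\<in>K. (a, k) \<in> mu"
  using K_cofinal by (auto simp: cofinal_def)

lemma K_infinite: "infinite K"
  using cofinal_infinite[OF mu_Card mu_inf K_Field K_cofinal] .

lemma finite_ordLess_K: "finite F \<Longrightarrow> |F| <o |K|"
  using K_infinite finite_ordLess_infinite[OF card_of_Well_order card_of_Well_order, of F K]
  by (simp add: Field_card_of)

text \<open>A set smaller than every cofinal one is not cofinal, and failure of the strict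
  \<open>cofinal\<close> at \<open>k\<close> is a weak bound by \<open>k\<close>.\<close>

lemma small_bounded:
  assumes L: "L \<subseteq> Field mu" "|L| <o |K|"
  shows "\<exists>k\<in>Field mu. \<forall>b\<in>L. (b, k) \<in> mu"
proof -
  have "\<not> cofinal L mu" using K_least[OF L(1)] L(2) not_ordLess_ordLeq by blast
  then obtain k where k: "k \<in> Field mu" "\<And>b. b \<in> L \<Longrightarrow> k = b \<or> (k, b) \<notin> mu"
    unfolding cofinal_def by blast
  have "(b, k) \<in> mu" if b: "b \<in> L" for b
  proof -
    have "b \<in> Field mu" using L(1) b by blast
    then show ?thesis using k(2)[OF b] k(1) M.TOTALS by blast
  qed
  then show ?thesis using k(1) by blast
qed

text \<open>Cofinality below \<theta>: \<open>F\<close> maps the fewer than \<theta> points of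
  \<open>C x\<close> to a bounded subset of \<open>mu\<close>, so all of \<open>C x\<close> survives
  the pigeonhole.\<close>

lemma large_antichain_low:
  assumes A: "pos A" and C: "\<And>x. x \<in> A \<Longrightarrow> \<exists>C\<subseteq>x. cofinal_in C x \<and> |C| <o |K|"
  shows "\<exists>W. antichain A W \<and> \<not> |W| \<le>o lam"
proof -
  obtain f where f: "\<And>x. x \<in> Z \<Longrightarrow> inj_on (f x) x" "\<And>x. x \<in> Z \<Longrightarrow> f x ` x \<subseteq> Field mu"
    using enumeration by blast
  have "\<forall>x. \<exists>C. x \<in> A \<longrightarrow> C \<subseteq> x \<and> cofinal_in C x \<and> |C| <o |K|" using C by blast
  from choice[OF this] obtain C where
    C: "\<And>x. x \<in> A \<Longrightarrow> C x \<subseteq> x \<and> cofinal_in (C x) x \<and> |C x| <o |K|" by blast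
  show ?thesis
  proof (rule large_antichain[OF A, where C = C])
    have "|K| \<le>o mu" using card_of_subset_ordLeq[OF K_Field card_of_Field_mu] .
    then show "|C x| <o mu" if "x \<in> A" for x using C[OF that] ordLess_ordLeq_trans by blast
    show "\<exists>k\<in>Field mu. cofinal_in {c \<in> C x. (F c, k) \<in> mu} x"
      if x: "x \<in> A" and F: "F ` C x \<subseteq> Field mu" for x F
    proof -
      have "|F ` C x| <o |K|" using C[OF x] card_of_image ordLeq_ordLess_trans by blast
      then obtain k where k: "k \<in> Field mu" "\<forall>b\<in>F ` C x. (b, k) \<in> mu"
        using small_bounded[OF F] by blast
      then have "{c \<in> C x. (F c, k) \<in> mu} = C x" by auto
      then have "cofinal_in {c \<in> C x. (F c, k) \<in> mu} x" using C[OF x] by metis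
      then show ?thesis using k(1) by (rule rev_bexI[rotated])
    qed
  qed (use C f in \<open>blast+\<close>)
qed

text \<open>If no piece were cofinal, each would stay below some \<open>b k\<close> in
  \<open>x\<close>. These at most \<theta> points are not cofinal, so some \<open>v \<in> x\<close>
  exceeds them all, and no piece could contain a point of \<open>C\<close> beyond
  \<open>v\<close>.\<close>

lemma high_pigeonhole:
  assumes x: "x \<in> Z" and high: "\<And>s. s \<subseteq> x \<Longrightarrow> |s| \<le>o |K| \<Longrightarrow> \<not> cofinal_in s x"
    and C: "C \<subseteq> x" "cofinal_in C x" and D: "\<And>c. c \<in> C \<Longrightarrow> \<exists>k\<in>K. c \<in> D k"
  shows "\<exists>k\<in>K. cofinal_in (D k) x"
proof (rule ccontr)
  assume "\<not> ?thesis"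
  then have "\<forall>k\<in>K. \<exists>b. b \<in> x \<and> (\<forall>c\<in>D k. (b, c) \<notin> lam)" unfolding cofinal_in_def by blast
  from bchoice[OF this] obtain b where b: "\<And>k. k \<in> K \<Longrightarrow> b k \<in> x"
    "\<And>k c. k \<in> K \<Longrightarrow> c \<in> D k \<Longrightarrow> (b k, c) \<notin> lam" by blast
  have "\<not> cofinal_in (b ` K) x" using b(1) by (intro high card_of_image) blast
  then obtain v where v: "v \<in> x" "\<And>k. k \<in> K \<Longrightarrow> (v, b k) \<notin> lam"
    unfolding cofinal_in_def by blast
  obtain c where c: "c \<in> C" "(v, c) \<in> lam" using C(2) v(1) unfolding cofinal_in_def by blast
  obtain k where k: "k \<in> K" "c \<in> D k" using D[OF c(1)] by blast
  have "v \<in> Field lam" "b k \<in> Field lam" using v(1) b(1)[OF k(1)] Z_Field[OF x] by auto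
  then have "(b k, v) \<in> lam" using v(2)[OF k(1)] L.TOTALS by blast
  then show False using b(2)[OF k] lam_trans[OF _ c(2)] by blast
qed

text \<open>Cofinality above \<theta>: a first pigeonhole over \<open>K\<close> cuts
  \<open>x\<close> to a cofinal piece numbered up to \<open>k x\<close>, hence of size less than
  \<open>mu\<close>; a second one treats the functions \<open>F\<close> on that piece.\<close>

lemma large_antichain_high:
  assumes A: "pos A" and high: "\<And>x s. x \<in> A \<Longrightarrow> s \<subseteq> x \<Longrightarrow> |s| \<le>o |K| \<Longrightarrow> \<not> cofinal_in s x"
  shows "\<exists>W. antichain A W \<and> \<not> |W| \<le>o lam"
proof -
  have AZ: "x \<in> Z" if "x \<in> A" for x using A that by (auto simp: pos_iff)
  obtain f where f: "\<And>x. x \<in> Z \<Longrightarrow> inj_on (f x) x" "\<And>x. x \<in> Z \<Longrightarrow> f x ` x \<subseteq> Field mu"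
    using enumeration by blast
  have "\<exists>k. k \<in> K \<and> cofinal_in {v \<in> x. (f x v, k) \<in> mu} x" if x: "x \<in> A" for x
  proof -
    have "cofinal_in x x" using lam_refl Z_Field[OF AZ[OF x]] unfolding cofinal_in_def by blast
    moreover have "\<exists>k\<in>K. v \<in> {v \<in> x. (f x v, k) \<in> mu}" if "v \<in> x" for v
      using K_bound[of "f x v"] f(2)[OF AZ[OF x]] that by blast
    ultimately have "\<exists>k\<in>K. cofinal_in {v \<in> x. (f x v, k) \<in> mu} x"
      by (intro high_pigeonhole[OF AZ[OF x] high[OF x] subset_refl])
    then show ?thesis by blast
  qed
  then obtain k where k: "\<And>x. x \<in> A \<Longrightarrow> k x \<in> K"
    "\<And>x. x \<in> A \<Longrightarrow> cofinal_in {v \<in> x. (f x v, k x) \<in> mu} x" by metis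
  show ?thesis
  proof (rule large_antichain[OF A, where C = "\<lambda>x. {v \<in> x. (f x v, k x) \<in> mu}"])
    show "|{v \<in> x. (f x v, k x) \<in> mu}| <o mu" if x: "x \<in> A" for x
    proof -
      have "inj_on (f x) {v \<in> x. (f x v, k x) \<in> mu}"
        using f(1)[OF AZ[OF x]] by (rule inj_on_subset) blast
      moreover have "f x ` {v \<in> x. (f x v, k x) \<in> mu} \<subseteq> under mu (k x)" by (auto simp: under_def)
      ultimately have "|{v \<in> x. (f x v, k x) \<in> mu}| \<le>o |under mu (k x)|" using card_of_ordLeq by blast
      moreover have "k x \<in> Field mu" using k(1)[OF x] K_Field by blast
      ultimately show ?thesis
        using card_of_under_ordLess[OF mu_Card mu_inf] ordLeq_ordLess_trans by blast
    qed
    show "\<exists>l\<in>Field mu. cofinal_in {c \<in> {v \<in> x. (f x v, k x) \<in> mu}. (F c, l) \<in> mu} x"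
      if x: "x \<in> A" and F: "F ` {v \<in> x. (f x v, k x) \<in> mu} \<subseteq> Field mu" for x F
    proof -
      have "\<exists>l\<in>K. cofinal_in {c \<in> {v \<in> x. (f x v, k x) \<in> mu}. (F c, l) \<in> mu} x"
      proof (rule high_pigeonhole[OF AZ[OF x] high[OF x] _ k(2)[OF x]])
        show "\<exists>l\<in>K. c \<in> {c \<in> {v \<in> x. (f x v, k x) \<in> mu}. (F c, l) \<in> mu}"
          if "c \<in> {v \<in> x. (f x v, k x) \<in> mu}" for c
          using K_bound[of "F c"] F that by blast
      qed auto
      then show ?thesis using K_Field by blast
    qed
  qed (use f in \<open>blast+\<close>)
qed

text \<open>
  Indices whose set is positive on \<open>bad\<close> are refined there; the others may discard \<open>bad\<close>, so
  the two parts never meet.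
\<close>

lemma refine_within_bad:
  assumes pos: "\<forall>i\<in>Field lam. pos (A i)"
    and bad: "\<forall>A. pos A \<longrightarrow> A \<subseteq> bad \<longrightarrow> (\<exists>W. antichain A W \<and> \<not> |W| \<le>o lam)"
  shows "\<exists>J B. J \<subseteq> Field lam \<and> (\<forall>i\<in>J. pos (B i) \<and> B i \<subseteq> A i \<inter> bad) \<and>
    (\<forall>i\<in>J. \<forall>j\<in>J. i \<noteq> j \<longrightarrow> B i \<inter> B j = {}) \<and> (\<forall>i\<in>Field lam - J. pos (A i - bad))"
proof -
  let ?J = "{i \<in> Field lam. pos (A i \<inter> bad)}"
  have "disjointly_refinable ?J (\<lambda>i. A i \<inter> bad)"
    by (rule disjointly_refinable_if_large_antichains) (use bad in auto)
  then obtain B where "\<forall>i\<in>?J. pos (B i) \<and> B i \<subseteq> A i \<inter> bad"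
    "\<forall>i\<in>?J. \<forall>j\<in>?J. i \<noteq> j \<longrightarrow> B i \<inter> B j = {}"
    unfolding disjointly_refinable_def by blast
  moreover have "pos (A i - bad)" if "i \<in> Field lam - ?J" for i
    using pos_Int_or_Diff[of "A i" bad] pos that by blast
  ultimately show ?thesis by (intro exI[of _ ?J] exI[of _ B]) simp
qed

section \<open>Refinements with small sections\<close>

lemma pos_hat: "pos A \<Longrightarrow> i \<in> Field lam \<Longrightarrow> pos {x \<in> A. i \<in> x}"
  using pos_Diff_null[OF _ fine, of A i] by (rule pos_mono) (auto simp: pos_iff)

text \<open>Where no set smaller than \<theta> is cofinal in \<open>x\<close>, the part of its
  section inside \<open>x\<close> has one bound \<open>q x\<close>, independent of the index. After
  pressing down, a point common to \<open>D i\<close> and \<open>D j\<close> gives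
  \<open>v i = q x = v j\<close>, and sets with equal bounds are disjoint.
  \<open>refine_within_bad\<close> treats the other points.\<close>

lemma disjointly_refinable_if_small_sections:
  assumes reg: "\<forall>A. (\<forall>i\<in>Field lam. pos (A i)) \<longrightarrow>
      (\<exists>B. (\<forall>i\<in>Field lam. pos (B i) \<and> B i \<subseteq> A i) \<and> (\<forall>x. |{i \<in> Field lam. x \<in> B i}| <o |K| ))"
    and pos: "\<forall>i\<in>Field lam. pos (A i)"
  shows "disjointly_refinable (Field lam) A"
proof -
  define bad where "bad = {x \<in> Z. \<exists>C\<subseteq>x. cofinal_in C x \<and> |C| <o |K| }"
  have "\<forall>A. pos A \<longrightarrow> A \<subseteq> bad \<longrightarrow> (\<exists>W. antichain A W \<and> \<not> |W| \<le>o lam)"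
    by (intro allI impI large_antichain_low) (auto simp: bad_def)
  from refine_within_bad[of A bad, OF pos this] obtain J B where J: "J \<subseteq> Field lam"
    and B: "\<forall>i\<in>J. pos (B i) \<and> B i \<subseteq> A i \<inter> bad" "\<forall>i\<in>J. \<forall>j\<in>J. i \<noteq> j \<longrightarrow> B i \<inter> B j = {}"
    and good: "\<forall>i\<in>Field lam - J. pos (A i - bad)" by (elim exE conjE)
  let ?J' = "Field lam - J"
  \<comment> \<open>The values at \<open>J\<close> are placeholders, as \<open>reg\<close> takes a
    family on all of \<open>Field lam\<close>; the final refinement uses \<open>B\<close>
    there.\<close>
  have "\<forall>i\<in>Field lam. pos (if i \<in> J then A i else A i - bad)" using pos good by simp
  from reg[THEN spec, THEN mp, OF this] obtain E
    where E: "\<And>i. i \<in> Field lam \<Longrightarrow> pos (E i) \<and> E i \<subseteq> (if i \<in> J then A i else A i - bad)"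
      "\<And>x. |{i \<in> Field lam. x \<in> E i}| <o |K|" by blast
  have "\<exists>v. v \<in> x \<and> (\<forall>i\<in>?J'. x \<in> E i \<longrightarrow> i \<in> x \<longrightarrow> (i, v) \<in> lam)"
    if x: "i \<in> ?J'" "x \<in> E i" for x i
  proof -
    \<comment> \<open>Indices outside \<open>x\<close> may be ignored, since \<open>E i\<close> is
      later cut down to the points containing \<open>i\<close>.\<close>
    let ?s = "{i \<in> ?J'. x \<in> E i \<and> i \<in> x}"
    have xZ: "x \<in> Z" "x \<notin> bad" using x E(1)[of i] by (auto simp: pos_iff)
    have "?s \<subseteq> {i \<in> Field lam. x \<in> E i}" by blast
    then have "|?s| <o |K|" using E(2)[of x] card_of_mono1 ordLeq_ordLess_trans by blast
    then have "\<not> cofinal_in ?s x" using xZ by (auto simp: bad_def)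
    then obtain v where v: "v \<in> x" "\<And>c. c \<in> ?s \<Longrightarrow> (v, c) \<notin> lam" unfolding cofinal_in_def by blast
    have "(c, v) \<in> lam" if "c \<in> ?s" for c
    proof -
      have "c \<in> Field lam" "v \<in> Field lam" using that v(1) Z_Field[OF xZ(1)] by auto
      then show ?thesis using v(2)[OF that] L.TOTALS by blast
    qed
    then show ?thesis using v(1) by blast
  qed
  then have "\<forall>x. \<exists>v. (\<exists>i\<in>?J'. x \<in> E i) \<longrightarrow>
      v \<in> x \<and> (\<forall>i\<in>?J'. x \<in> E i \<longrightarrow> i \<in> x \<longrightarrow> (i, v) \<in> lam)" by blast
  from choice[OF this] obtain q where q: "\<And>x. \<exists>i\<in>?J'. x \<in> E i \<Longrightarrow>
      q x \<in> x \<and> (\<forall>i\<in>?J'. x \<in> E i \<longrightarrow> i \<in> x \<longrightarrow> (i, q x) \<in> lam)" by blast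
  have "\<exists>D v. (\<forall>i\<in>?J'. pos (D i) \<and> D i \<subseteq> {x \<in> E i. i \<in> x} \<and> (\<forall>x\<in>D i. q x = v i)) \<and>
    (\<forall>i\<in>?J'. \<forall>j\<in>?J'. i \<noteq> j \<longrightarrow> v i = v j \<longrightarrow> D i \<inter> D j = {})"
  proof (rule refine_constant_bound)
    show "pos {x \<in> E i. i \<in> x}" if "i \<in> ?J'" for i
      using E(1)[of i] that by (intro pos_hat) simp_all
    show "q x \<in> x \<and> (i, q x) \<in> lam" if "i \<in> ?J'" "x \<in> {x \<in> E i. i \<in> x}" for i x
      using q[of x] that by blast
  qed blast
  then obtain D v where D: "\<And>i. i \<in> ?J' \<Longrightarrow> pos (D i) \<and> D i \<subseteq> {x \<in> E i. i \<in> x} \<and> (\<forall>x\<in>D i. q x = v i)"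
    and D_disj: "\<And>i j. i \<in> ?J' \<Longrightarrow> j \<in> ?J' \<Longrightarrow> i \<noteq> j \<Longrightarrow> v i = v j \<Longrightarrow> D i \<inter> D j = {}" by blast
  have DA: "D i \<subseteq> A i - bad" if "i \<in> ?J'" for i using D[OF that] E(1)[of i] that by auto
  have "D i \<inter> D j = {}" if ij: "i \<in> ?J'" "j \<in> ?J'" "i \<noteq> j" for i j
  proof (cases "v i = v j")
    case False
    then show ?thesis using D[OF ij(1)] D[OF ij(2)] by auto
  qed (rule D_disj[OF ij])
  then have D_all: "D i \<inter> D j = {}" if "i \<in> ?J'" "j \<in> ?J'" "i \<noteq> j" for i j using that by blast
  have BD: "B i \<inter> D j = {}" "D j \<inter> B i = {}" if "i \<in> J" "j \<in> ?J'" for i j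
    using DA[OF that(2)] B(1) that(1) by blast+
  let ?F = "\<lambda>i. if i \<in> J then B i else D i"
  have "pos (?F i) \<and> ?F i \<subseteq> A i" if "i \<in> Field lam" for i
    using B(1) D[of i] DA[of i] that by (cases "i \<in> J") auto
  moreover have "?F i \<inter> ?F j = {}" if "i \<in> Field lam" "j \<in> Field lam" "i \<noteq> j" for i j
    using that B(2) BD[of i j] BD[of j i] D_all[of i j] by (cases "i \<in> J"; cases "j \<in> J") simp_all
  ultimately show ?thesis unfolding disjointly_refinable_def by (intro exI[of _ ?F]) blast
qed

text \<open>Well-order \<open>C\<close> in type \<open>|C|\<close> and keep the points that lie
  above all their predecessors. On these the order of \<open>lam\<close> agrees with the new one,
  whose initial segments are smaller than \<open>|K|\<close>.\<close>

lemma thin_cofinal_subset: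
  assumes C: "C \<subseteq> Field lam" "|C| \<le>o |K|"
  shows "\<exists>C'\<subseteq>C. (\<forall>v\<in>C. \<exists>c\<in>C'. (v, c) \<in> lam) \<and> (\<forall>v\<in>C'. |{c \<in> C'. (c, v) \<in> lam}| <o |K| )"
proof -
  interpret r: wo_rel "|C|" by (simp add: wo_rel_def card_of_Well_order)
  let ?C' = "{c \<in> C. \<forall>d\<in>underS |C| c. (d, c) \<in> lam}"
  have "\<exists>c\<in>?C'. (v, c) \<in> lam" if v: "v \<in> C" for v
  proof -
    have "v \<in> {c \<in> C. (v, c) \<in> lam}" using v C(1) lam_refl by blast
    \<comment> \<open>The first point of \<open>C\<close> at or above \<open>v\<close> is kept,
      because its predecessors lie below \<open>v\<close>.\<close>
    then have "\<exists>c\<in>{c \<in> C. (v, c) \<in> lam}. \<forall>d\<in>{c \<in> C. (v, c) \<in> lam}. (c, d) \<in> |C|"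
      by (intro well_order_least[OF card_of_Well_order]) (auto simp: Field_card_of)
    then obtain c where c: "c \<in> C" "(v, c) \<in> lam"
      and least: "\<And>d. d \<in> C \<Longrightarrow> (v, d) \<in> lam \<Longrightarrow> (c, d) \<in> |C|" by blast
    have "(d, c) \<in> lam" if d: "d \<in> underS |C| c" for d
    proof -
      have dc: "d \<in> C" "d \<noteq> c" "(d, c) \<in> |C|"
        using d by (auto simp: underS_def dest: FieldI1 simp: Field_card_of)
      then have "(v, d) \<notin> lam" using least r.ANTISYM by (meson antisymD)
      then have "(d, v) \<in> lam" using L.TOTALS dc(1) v C(1) by blast
      then show ?thesis using c(2) lam_trans by blast
    qed
    then show ?thesis using c by blast
  qed
  moreover have "|{c \<in> ?C'. (c, v) \<in> lam}| <o |K|" if v: "v \<in> ?C'" for v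
  proof -
    have "{c \<in> ?C'. (c, v) \<in> lam} \<subseteq> under |C| v"
    proof
      fix c assume c: "c \<in> {c \<in> ?C'. (c, v) \<in> lam}"
      show "c \<in> under |C| v"
      proof (rule ccontr)
        assume "c \<notin> under |C| v"
        then have "(c, v) \<notin> |C|" by (simp add: under_def)
        then have "(v, c) \<in> |C|" "v \<noteq> c"
          using r.TOTALS v c by (auto simp: Field_card_of)
        then have "(v, c) \<in> lam" using c by (auto simp: underS_def)
        then show False using c lam_antisym \<open>v \<noteq> c\<close> by blast
      qed
    qed
    moreover have "|under |C| v| <o |K|"
    proof (cases "finite C")
      case True
      then have "finite (under |C| v)"
        using Order_Relation.under_Field[of "|C|" v] finite_subset by (auto simp: Field_card_of)
      then show ?thesis by (rule finite_ordLess_K)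
    next
      case False
      then have "|under |C| v| <o |C|"
        using v by (intro card_of_under_ordLess[OF card_of_Card_order]) (auto simp: Field_card_of)
      then show ?thesis using C(2) ordLess_ordLeq_trans by blast
    qed
    ultimately show ?thesis using card_of_mono1 ordLeq_ordLess_trans by blast
  qed
  ultimately show ?thesis by (intro exI[of _ ?C']) blast
qed

text \<open>Where \<open>x\<close> has a cofinal set of size at most \<theta>, thin it to
  \<open>C x\<close> and press down on the least point \<open>q i x\<close> of \<open>C x\<close> at
  or above \<open>i\<close>. For indices \<open>i\<close> below \<open>j\<close> in the section of
  \<open>x\<close>, the \<open>v i\<close> are distinct points of \<open>C x\<close> up to
  \<open>q j x\<close>, hence fewer than \<theta>.\<close>

lemma refine_small_initial_sections:
  assumes pos: "\<forall>i\<in>Field lam. pos (A i)"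
  shows "\<exists>B. (\<forall>i\<in>Field lam. pos (B i) \<and> B i \<subseteq> A i) \<and>
    (\<forall>j\<in>Field lam. \<forall>x\<in>B j. |{i \<in> underS lam j. x \<in> B i}| <o |K| )"
proof -
  define bad where "bad = {x \<in> Z. \<forall>C\<subseteq>x. |C| \<le>o |K| \<longrightarrow> \<not> cofinal_in C x}"
  have "\<forall>A. pos A \<longrightarrow> A \<subseteq> bad \<longrightarrow> (\<exists>W. antichain A W \<and> \<not> |W| \<le>o lam)"
    by (intro allI impI large_antichain_high) (auto simp: bad_def)
  from refine_within_bad[of A bad, OF pos this] obtain J B where J: "J \<subseteq> Field lam"
    and B: "\<forall>i\<in>J. pos (B i) \<and> B i \<subseteq> A i \<inter> bad" "\<forall>i\<in>J. \<forall>j\<in>J. i \<noteq> j \<longrightarrow> B i \<inter> B j = {}"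
    and good: "\<forall>i\<in>Field lam - J. pos (A i - bad)" by (elim exE conjE)
  let ?J' = "Field lam - J"
  have "\<exists>C. x \<in> Z - bad \<longrightarrow> C \<subseteq> x \<and> cofinal_in C x \<and> (\<forall>v\<in>C. |{c \<in> C. (c, v) \<in> lam}| <o |K| )" for x
  proof (cases "x \<in> Z - bad")
    case True
    then obtain C where C: "C \<subseteq> x" "|C| \<le>o |K|" "cofinal_in C x" by (auto simp: bad_def)
    have "C \<subseteq> Field lam" using C(1) Z_Field True by blast
    from thin_cofinal_subset[OF this C(2)] obtain C' where C': "C' \<subseteq> C"
      "\<forall>v\<in>C. \<exists>c\<in>C'. (v, c) \<in> lam" "\<forall>v\<in>C'. |{c \<in> C'. (c, v) \<in> lam}| <o |K|" by blast
    have "cofinal_in C' x" using C(3) C'(2) lam_trans unfolding cofinal_in_def by blast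
    then show ?thesis using C(1) C'(1,3) by blast
  qed auto
  then have "\<forall>x. \<exists>C. x \<in> Z - bad \<longrightarrow>
      C \<subseteq> x \<and> cofinal_in C x \<and> (\<forall>v\<in>C. |{c \<in> C. (c, v) \<in> lam}| <o |K| )" by (rule allI)
  from choice[OF this] obtain C where "\<forall>x. x \<in> Z - bad \<longrightarrow>
      C x \<subseteq> x \<and> cofinal_in (C x) x \<and> (\<forall>v\<in>C x. |{c \<in> C x. (c, v) \<in> lam}| <o |K| )" by (rule exE)
  then have C: "\<And>x. x \<in> Z - bad \<Longrightarrow> C x \<subseteq> x" "\<And>x. x \<in> Z - bad \<Longrightarrow> cofinal_in (C x) x"
    "\<And>x v. x \<in> Z - bad \<Longrightarrow> v \<in> C x \<Longrightarrow> |{c \<in> C x. (c, v) \<in> lam}| <o |K|" by simp_all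
  define q where "q i x = (SOME c. c \<in> C x \<and> (i, c) \<in> lam \<and> (\<forall>d\<in>C x. (i, d) \<in> lam \<longrightarrow> (c, d) \<in> lam))" for i x
  have q: "q i x \<in> C x \<and> (i, q i x) \<in> lam \<and> (\<forall>d\<in>C x. (i, d) \<in> lam \<longrightarrow> (q i x, d) \<in> lam)"
    if x: "x \<in> Z - bad" "i \<in> x" for x i
  proof -
    obtain b where b: "b \<in> {c \<in> C x. (i, c) \<in> lam}"
      using C(2)[OF x(1)] x(2) unfolding cofinal_in_def by blast
    have "{c \<in> C x. (i, c) \<in> lam} \<subseteq> Field lam" using C(1)[OF x(1)] Z_Field[of x] x(1) by blast
    then have "\<exists>c\<in>{c \<in> C x. (i, c) \<in> lam}. \<forall>d\<in>{c \<in> C x. (i, c) \<in> lam}. (c, d) \<in> lam"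
      using b by (rule well_order_least[OF L.WELL])
    then have "\<exists>c. c \<in> C x \<and> (i, c) \<in> lam \<and> (\<forall>d\<in>C x. (i, d) \<in> lam \<longrightarrow> (c, d) \<in> lam)" by blast
    then show ?thesis unfolding q_def by (rule someI_ex)
  qed
  have AZ: "A i \<subseteq> Z" if "i \<in> Field lam" for i using pos that by (simp add: pos_iff)
  have "\<exists>D v. (\<forall>i\<in>?J'. pos (D i) \<and> D i \<subseteq> {x \<in> A i - bad. i \<in> x} \<and> (\<forall>x\<in>D i. q i x = v i)) \<and>
    (\<forall>i\<in>?J'. \<forall>j\<in>?J'. i \<noteq> j \<longrightarrow> v i = v j \<longrightarrow> D i \<inter> D j = {})"
  proof (rule refine_constant_bound)
    show "pos {x \<in> A i - bad. i \<in> x}" if "i \<in> ?J'" for i using good that by (intro pos_hat) auto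
    show "q i x \<in> x \<and> (i, q i x) \<in> lam" if "i \<in> ?J'" "x \<in> {x \<in> A i - bad. i \<in> x}" for i x
    proof -
      have "x \<in> Z - bad" "i \<in> x" using that AZ by auto
      then show ?thesis using q[of x i] C(1)[of x] by blast
    qed
  qed blast
  then obtain D v where D: "\<And>i. i \<in> ?J' \<Longrightarrow> pos (D i) \<and> D i \<subseteq> {x \<in> A i - bad. i \<in> x} \<and> (\<forall>x\<in>D i. q i x = v i)"
    and D_disj: "\<And>i j. i \<in> ?J' \<Longrightarrow> j \<in> ?J' \<Longrightarrow> i \<noteq> j \<Longrightarrow> v i = v j \<Longrightarrow> D i \<inter> D j = {}" by blast
  let ?B = "\<lambda>i. if i \<in> J then B i else D i"
  have "|{i \<in> underS lam j. x \<in> ?B i}| <o |K|" if j: "j \<in> Field lam" "x \<in> ?B j" for j x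
  proof (cases "j \<in> J")
    case True
    then have xb: "x \<in> B j" "x \<in> bad" using j(2) B(1) by auto
    \<comment> \<open>The sets \<open>D i\<close> avoid \<open>bad\<close>, which contains
      \<open>x\<close>, and the sets \<open>B i\<close> are pairwise disjoint.\<close>
    have e: "{i \<in> underS lam j. x \<in> ?B i} = {}"
    proof (rule ccontr)
      assume "\<not> ?thesis"
      then obtain i where i: "i \<in> underS lam j" "x \<in> ?B i" by blast
      have iF: "i \<in> Field lam" "i \<noteq> j" using i(1) by (auto simp: underS_def Field_def)
      have "i \<in> J" using D[of i] i(2) iF xb(2) by (auto split: if_splits)
      then show False using B(2) True iF(2) i(2) xb(1) by auto
    qed
    show ?thesis unfolding e by (rule finite_ordLess_K) simp
  next
    case False
    then have jJ: "j \<in> ?J'" and xD: "x \<in> D j" using j by auto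
    have x: "x \<in> Z - bad" "j \<in> x" using D[OF jJ] xD AZ[OF j(1)] by auto
    let ?s = "{i \<in> underS lam j. x \<in> ?B i}"
    have s: "i \<in> ?J'" "x \<in> D i" "(i, j) \<in> lam" if "i \<in> ?s" for i
      using that B(1) x(1) by (auto simp: underS_def Field_def split: if_splits)
    have sx: "i \<in> x" "q i x = v i" if "i \<in> ?s" for i
      using D[OF s(1)[OF that]] s(2)[OF that] by auto
    \<comment> \<open>Equal values of \<open>v\<close> would make the sets disjoint, but they share
      \<open>x\<close>.\<close>
    have "inj_on v ?s"
    proof (rule inj_onI, rule ccontr)
      fix i i' assume i: "i \<in> ?s" "i' \<in> ?s" "v i = v i'" "i \<noteq> i'"
      then show False using D_disj[OF s(1)[OF i(1)] s(1)[OF i(2)] i(4,3)] s(2)[OF i(1)] s(2)[OF i(2)] by blast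
    qed
    \<comment> \<open>By leastness \<open>q i x\<close> is monotone in \<open>i\<close>.\<close>
    moreover have "v ` ?s \<subseteq> {c \<in> C x. (c, q j x) \<in> lam}"
    proof
      fix c assume "c \<in> v ` ?s"
      then obtain i where i: "i \<in> ?s" "c = v i" by blast
      have "(i, q j x) \<in> lam" using lam_trans[OF s(3)[OF i(1)]] q[OF x] by blast
      then show "c \<in> {c \<in> C x. (c, q j x) \<in> lam}"
        using q[OF x(1) sx(1)[OF i(1)]] q[OF x] sx(2)[OF i(1)] i(2) by simp
    qed
    ultimately have "|?s| \<le>o |{c \<in> C x. (c, q j x) \<in> lam}|" using card_of_ordLeq by blast
    moreover have "|{c \<in> C x. (c, q j x) \<in> lam}| <o |K|" using C(3)[OF x(1)] q[OF x] by blast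
    ultimately show ?thesis by (rule ordLeq_ordLess_trans)
  qed
  moreover have "pos (?B i) \<and> ?B i \<subseteq> A i" if "i \<in> Field lam" for i
    using B(1) D[of i] that by auto
  ultimately show ?thesis by (intro exI[of _ ?B]) blast
qed

text \<open>A section of size at least \<theta> would contain an index set of order type \<theta>
  whose sets share a point, so regularity makes every section smaller than \<theta>.\<close>

lemma regular_if_cf_regular:
  assumes "ord_regular_ideal ( |K| ) lam Z I"
  shows "regular_ideal lam Z I"
  unfolding regular_ideal_def ord_regular_ideal_def
proof (intro allI impI)
  fix A assume A: "\<forall>i\<in>Field lam. pos (A i)"
  have "disjointly_refinable (Field lam) A"
  proof (rule disjointly_refinable_if_small_sections[OF _ A], intro allI impI)
    fix A' assume "\<forall>i\<in>Field lam. pos (A' i)"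
    with assms have "\<exists>B. (\<forall>i\<in>Field lam. pos (B i) \<and> B i \<subseteq> A' i) \<and>
        (\<forall>z\<subseteq>Field lam. Restr lam z =o |K| \<longrightarrow> (\<Inter>i\<in>z. B i) = {})"
      unfolding ord_regular_ideal_def by simp
    then obtain B where B: "\<forall>i\<in>Field lam. pos (B i) \<and> B i \<subseteq> A' i"
      "\<forall>z\<subseteq>Field lam. Restr lam z =o |K| \<longrightarrow> (\<Inter>i\<in>z. B i) = {}" by (elim exE conjE)
    have "|{i \<in> Field lam. x \<in> B i}| <o |K|" for x
    proof (rule ccontr)
      assume "\<not> ?thesis"
      then have "|K| \<le>o |{i \<in> Field lam. x \<in> B i}|"
        by (simp add: not_ordLess_iff_ordLeq card_of_Well_order)
      then obtain z where z: "z \<subseteq> {i \<in> Field lam. x \<in> B i}" "Restr lam z =o |K|"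
        using subset_of_order_type[OF lam_Card, of "{i \<in> Field lam. x \<in> B i}" K] by blast
      then have "(\<Inter>i\<in>z. B i) = {}" using B(2) by blast
      then show False using z(1) by blast
    qed
    then show "\<exists>B. (\<forall>i\<in>Field lam. pos (B i) \<and> B i \<subseteq> A' i) \<and>
        (\<forall>x. |{i \<in> Field lam. x \<in> B i}| <o |K| )" using B(1) by blast
  qed
  then obtain B where B: "\<forall>i\<in>Field lam. pos (B i) \<and> B i \<subseteq> A i"
    "\<forall>i\<in>Field lam. \<forall>j\<in>Field lam. i \<noteq> j \<longrightarrow> B i \<inter> B j = {}"
    unfolding disjointly_refinable_def by blast
  have "(\<Inter>i\<in>z. B i) = {}" if z: "z \<subseteq> Field lam" "Restr lam z =o natLeq_on 2" for z
  proof -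
    obtain i j where ij: "i \<in> z" "j \<in> z" "i \<noteq> j" using two_elements[OF lam_Card z] by blast
    then have "B i \<inter> B j = {}" using B(2) z(1) by blast
    then show ?thesis using ij by blast
  qed
  then show "\<exists>B. (\<forall>i\<in>Field lam. pos (B i) \<and> B i \<subseteq> A i) \<and>
      (\<forall>z\<subseteq>Field lam. Restr lam z =o natLeq_on 2 \<longrightarrow> \<Inter> (B ` z) = {})" using B(1) by blast
qed

text \<open>An index set of type \<theta> + 1 whose sets share \<open>x\<close> has a last element
  \<open>j\<close> with \<theta> members below it, too many for the initial section of
  \<open>x\<close> at \<open>j\<close>.\<close>

lemma ord_succ_cf_regular: "ord_regular_ideal (ord_succ ( |K| )) lam Z I"
  unfolding ord_regular_ideal_def
proof (intro allI impI)
  fix A assume "\<forall>i\<in>Field lam. pos (A i)"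
  from refine_small_initial_sections[OF this]
  obtain B where B: "\<forall>i\<in>Field lam. pos (B i) \<and> B i \<subseteq> A i"
    "\<forall>j\<in>Field lam. \<forall>x\<in>B j. |{i \<in> underS lam j. x \<in> B i}| <o |K|" by (elim exE conjE)
  have "(\<Inter>i\<in>z. B i) = {}" if z: "z \<subseteq> Field lam" "Restr lam z =o ord_succ |K|" for z
  proof (rule ccontr)
    assume "\<not> ?thesis"
    then obtain x where x: "\<And>i. i \<in> z \<Longrightarrow> x \<in> B i" by blast
    obtain j where j: "j \<in> z" "|K| \<le>o |{i \<in> underS lam j. i \<in> z}|"
      using card_of_section[OF lam_Card z] by (auto simp: Field_card_of)
    have "{i \<in> underS lam j. i \<in> z} \<subseteq> {i \<in> underS lam j. x \<in> B i}" using x by blast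
    then have "|K| \<le>o |{i \<in> underS lam j. x \<in> B i}|"
      using j(2) card_of_mono1 ordLeq_transitive by blast
    moreover have "|{i \<in> underS lam j. x \<in> B i}| <o |K|" using B(2) j(1) x z(1) by blast
    ultimately show False using not_ordLess_ordLeq by blast
  qed
  then show "\<exists>B. (\<forall>i\<in>Field lam. pos (B i) \<and> B i \<subseteq> A i) \<and>
      (\<forall>z\<subseteq>Field lam. Restr lam z =o ord_succ |K| \<longrightarrow> \<Inter> (B ` z) = {})" using B(1) by blast
qed

end

subsection \<open>Ideals on the small subsets of a cardinal\<close>

lemma small_normal_ideal_P_less:
  fixes mu :: "'b rel" and lam :: "'a rel" and I :: "'a set set set"
  defines "\<kappa> \<equiv> cardSuc mu"
  assumes mu: "Cinfinite mu" and lam: "Card_order lam"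
    and ideal: "ideal_on (P_less \<kappa> (Field lam)) I"
    and compl: "complete_ideal \<kappa> I"
    and norm: "normal_ideal (Field lam) (P_less \<kappa> (Field lam)) I"
  shows "small_normal_ideal mu lam (P_less \<kappa> (Field lam)) I"
proof -
  let ?Z = "P_less \<kappa> (Field lam)"
  have mu': "Card_order mu" "infinite (Field mu)" using mu by (auto simp: cinfinite_def)
  have Z: "z \<in> ?Z \<longleftrightarrow> z \<subseteq> Field lam \<and> |z| \<le>o mu" for z
    by (simp add: P_less_def cardSuc_ordLeq_ordLess mu' card_of_Card_order \<kappa>_def)
  have sub: "A \<subseteq> ?Z" if "A \<in> I" for A using ideal that by (auto simp: ideal_on_def)
  have mono: "B \<in> I" if "A \<in> I" "B \<subseteq> A" for A B using ideal that unfolding ideal_on_def by blast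
  have Union: "\<Union>S \<in> I" if "S \<subseteq> I" "|S| \<le>o mu" for S
    using compl that cardSuc_ordLeq_ordLess[OF mu'(1) card_of_Card_order, of S]
    unfolding complete_ideal_def \<kappa>_def by blast
  have fine: "{z \<in> ?Z. v \<notin> z} \<in> I" if "v \<in> Field lam" for v
  proof -
    have "?Z - hat ?Z v \<in> I" using norm that by (auto simp: normal_ideal_def dual_filter_def)
    moreover have "?Z - hat ?Z v = {z \<in> ?Z. v \<notin> z}" by (auto simp: hat_def)
    ultimately show ?thesis by simp
  qed
  \<comment> \<open>If \<open>lam\<close> were at most \<open>mu\<close>, \<open>Field lam\<close>
    would itself be a point of \<open>?Z\<close>, and fineness with completeness would make the set
    of all other points null. Then \<open>I\<close> is the principal ideal of the sets avoiding this
    point, which \<open>ideal_on\<close> excludes.\<close>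
  have mu_lam: "mu <o lam"
  proof (rule ccontr)
    assume "\<not> mu <o lam"
    then have le: "lam \<le>o mu"
      using mu'(1) lam by (simp add: card_order_on_def not_ordLess_iff_ordLeq)
    let ?X = "Field lam"
    have X: "|?X| \<le>o mu"
      using card_of_Field_ordIso[OF lam] le ordIso_ordLeq_trans by blast
    then have XZ: "?X \<in> ?Z" using Z by blast
    have "|(\<lambda>v. {z \<in> ?Z. v \<notin> z}) ` ?X| \<le>o mu" using X card_of_image ordLeq_transitive by blast
    then have "(\<Union>v\<in>?X. {z \<in> ?Z. v \<notin> z}) \<in> I" using fine by (intro Union) auto
    moreover have "(\<Union>v\<in>?X. {z \<in> ?Z. v \<notin> z}) = ?Z - {?X}" using Z by auto
    ultimately have co: "?Z - {?X} \<in> I" by simp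
    have "?X \<notin> A" if "A \<in> I" for A
    proof
      assume "?X \<in> A"
      then have "?Z \<subseteq> A \<union> (?Z - {?X})" by blast
      moreover have "A \<union> (?Z - {?X}) \<in> I" using ideal that co unfolding ideal_on_def by blast
      ultimately have "?Z \<in> I" by (rule mono[rotated])
      then show False using ideal by (simp add: ideal_on_def)
    qed
    then have "I = Pow (?Z - {?X})" using sub mono[OF co] by blast
    then show False using ideal unfolding ideal_on_def by blast
  qed
  have diagonal: "{z \<in> ?Z. \<exists>v\<in>z. z \<in> F v} \<in> I" if "\<And>v. v \<in> Field lam \<Longrightarrow> F v \<in> I" for F
  proof -
    have "(\<Union>v\<in>Field lam. F v \<inter> hat ?Z v) \<in> I" using norm that unfolding normal_ideal_def by blast
    then show ?thesis by (rule mono) (use Z in \<open>auto simp: hat_def\<close>)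
  qed
  show ?thesis
  proof
    show "z \<subseteq> Field lam" "|z| \<le>o mu" if "z \<in> ?Z" for z using Z that by blast+
  qed (fact mu' lam mu_lam sub mono Union fine diagonal)+
qed

theorem theorem9:
  fixes \<mu> :: "'b rel" and \<kappa> :: "'b set rel" and lam :: "'a rel"
    and I :: "'a set set set"
  assumes "Cinfinite \<mu>" and "\<kappa> = cardSuc \<mu>" and "Card_order lam"
    and "ideal_on (P_less \<kappa> (Field lam)) I"
    and "complete_ideal \<kappa> I"
    and "normal_ideal (Field lam) (P_less \<kappa> (Field lam)) I"
  shows "(ord_regular_ideal (cf \<mu>) lam (P_less \<kappa> (Field lam)) I
            \<longrightarrow> regular_ideal lam (P_less \<kappa> (Field lam)) I)
       \<and> (regularCard lam
            \<longrightarrow> ord_regular_ideal (ord_succ (cf \<mu>)) lam (P_less \<kappa> (Field lam)) I)"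
proof -
  interpret small_normal_ideal \<mu> lam "P_less \<kappa> (Field lam)" I
    using small_normal_ideal_P_less[of \<mu> lam I] assms by simp
  obtain K where K: "K \<subseteq> Field \<mu>" "cofinal K \<mu>" "cf \<mu> = |K|"
    "\<forall>L\<subseteq>Field \<mu>. cofinal L \<mu> \<longrightarrow> |K| \<le>o |L|"
    using cf_witness[OF mu_Card mu_inf] by blast
  interpret small_normal_ideal_cf \<mu> lam "P_less \<kappa> (Field lam)" I K
    using K by unfold_locales blast+
  show ?thesis unfolding K(3) using regular_if_cf_regular ord_succ_cf_regular by blast
qed

end
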